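(* Let $p\colon\mathbb{R}\to\mathbb{R}$ be bounded and uniformly continuous, and assume that $x'=-x^2+p(t)$ has exactly two hyperbolic solutions. Suppose that there exists $c_0>0$ such that the family $$y'=-\Big(y-\frac{2}{\pi}\arctan(ct)\Big)^2+p(t)\qquad(E_c)$$ admits a transversal rate-induced tipping at $c=c_0$, i.e. $\lambda_*(c_0)=0$ and there exists $\delta_0>0$ such that $\lambda_*(c)<0$ for $c\in[c_0-\delta_0,c_0)$ and $\lambda_*(c)>0$ for $c\in(c_0,c_0+\delta_0]$. Let $\mathfrak{b}_{c_0}$ be the unique bounded solution of $(E_{c_0})$. Then, with $\mathfrak{a}_c,\mathfrak{r}_c,\mathcal{R}_c^\pm$ as in the context: (i) As $c$ increases to $c_0$, the upper and lower bounds of the set of bounded solutions collide in the sense that $$\lim_{c\to c_0^-}\mathfrak{a}_c=\mathfrak{b}_{c_0}\ \text{ uniformly on the negative half-lines of }\mathbb{R},\qquad \lim_{c\to c_0^-}\mathfrak{r}_c=\mathfrak{b}_{c_0}\ \text{ uniformly on the positive half-lines of }\mathbb{R}.$$ (ii) As $c$ decreases to $c_0$, the half-line domains $\mathcal{R}_c^-$ and $\mathcal{R}_c^+$ of $\mathfrak{a}_c$ and $\mathfrak{r}_c$ satisfy $$\lim_{c\to c_0^+}\sup\mathcal{R}_c^-=\infty\quad\text{and}\quad\lim_{c\to c_0^+}\inf\mathcal{R}_c^+=-\infty,$$ and the limits in (i) hold also as $c\to c_0^+$: $\mathfrak{a}_c\to\mathfrak{b}_{c_0}$ uniformly on the negative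 half-lines of $\mathbb{R}$ and $\mathfrak{r}_c\to\mathfrak{b}_{c_0}$ uniformly on the positive half-lines of $\mathbb{R}$.
   Context: "Bounded solution" means defined and bounded on $\mathbb{R}$. Negative (positive) half-lines are the sets $(-\infty,k]$ (resp. $[k,\infty)$), $k\in\mathbb{R}$. For $c\ge0$ let $q_c(t):=\frac{2c}{\pi(c^2t^2+1)}$. The number $\lambda_*(c)\in\mathbb{R}$ is characterized as the unique real number such that $x'=-x^2+p(t)-q_c(t)+\lambda$ has a bounded solution if and only if $\lambda\ge\lambda_*(c)$ (it exists). This defines $\lambda_*\colon[0,\infty)\to\mathbb{R}$. For $c>0$ and under the assumption on $p$: $(E_c)$ has two different hyperbolic solutions if $\lambda_*(c)<0$, exactly one bounded solution if $\lambda_*(c)=0$, and no bounded solutions if $\lambda_*(c)>0$. $t\mapsto y_c(t,s,y_0)$ is the maximal solution of $(E_c)$ with $y_c(s,s,y_0)=y_0$. $\mathcal{R}_c^-$ is the set of $s\in\mathbb{R}$ for which there is $y_0$ such that $y_c(\cdot,s,y_0)$ is bounded above on the part of its maximal interval to the left of $s$, and $\mathfrak{a}_c(s)$ is the maximum of these $y_0$. $\mathcal{R}_c^+$ is the set of $s$ for which there is $y_0$ such that $y_c(\cdot,s,y_0)$ is bounded below on the part of its maximal interval to the right of $s$, and $\mathfrak{r}_c(s)$ is the minimum of these $y_0$. Under the assumption on $p$, for $c>0$, $\mathfrak{a}_c\colon\mathcal{R}_c^-\to\mathbb{R}$ and $\mathfrak{r}_c\colon\mathcal{R}_c^+\to\mathbb{R}$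 exist and are solutions of $(E_c)$; $\mathcal{R}_c^-$ is $\mathbb{R}$ or an open half-line $(-\infty,l)$, $\mathcal{R}_c^+$ is $\mathbb{R}$ or an open half-line $(l,\infty)$; and both equal $\mathbb{R}$ iff $(E_c)$ has a bounded solution. A globally defined solution $\tilde b$ of a scalar equation $x'=h(t,x)$ is hyperbolic if there are $k\ge1$, $\beta>0$ such that either $\exp\int_s^t\frac{\partial h}{\partial x}(l,\tilde b(l))\,dl\le k\,e^{-\beta(t-s)}$ whenever $t\ge s$, or $\exp\int_s^t\frac{\partial h}{\partial x}(l,\tilde b(l))\,dl\le k\,e^{\beta(t-s)}$ whenever $t\le s$. *)

theory Defs
  imports "HOL-Analysis.Analysis"
begin

text \<open>A scalar equation \<open>x' = h(t,x)\<close> is given by its right-hand side \<open>h t x\<close>.\<close>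

definition global_solution :: "(real \<Rightarrow> real \<Rightarrow> real) \<Rightarrow> (real \<Rightarrow> real) \<Rightarrow> bool" where
  "global_solution h x \<longleftrightarrow> (\<forall>t. (x has_real_derivative h t (x t)) (at t))"

definition bounded_solution :: "(real \<Rightarrow> real \<Rightarrow> real) \<Rightarrow> (real \<Rightarrow> real) \<Rightarrow> bool" where
  "bounded_solution h x \<longleftrightarrow> global_solution h x \<and> bounded (range x)"

text \<open>The interval integral is oriented, so for \<open>t \<le> s\<close> it is minus the integral over
  \<open>[t, s]\<close>, as the second alternative requires.\<close>

definition hyperbolic_solution :: "(real \<Rightarrow> real \<Rightarrow> real) \<Rightarrow> (real \<Rightarrow> real) \<Rightarrow> bool" where
  "hyperbolic_solution h b \<longleftrightarrow> global_solution h b \<and>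
     (\<exists>k\<ge>1. \<exists>\<beta>>0.
        (\<forall>s t. t \<ge> s \<longrightarrow>
           exp (LBINT l=ereal s..ereal t. deriv (\<lambda>x. h l x) (b l)) \<le> k * exp (- \<beta> * (t - s))) \<or>
        (\<forall>s t. t \<le> s \<longrightarrow>
           exp (LBINT l=ereal s..ereal t. deriv (\<lambda>x. h l x) (b l)) \<le> k * exp (\<beta> * (t - s))))"

text \<open>Maximal solutions: the maximal interval is the union of all open intervals carrying a
  solution of the initial value problem, and the maximal solution is the common value of these
  solutions (they agree where they overlap if \<open>h\<close> is continuous and locally Lipschitz in \<open>x\<close>).
  Values outside the maximal interval are meaningless.\<close>

definition ivp_solution ::
    "(real \<Rightarrow> real \<Rightarrow> real) \<Rightarrow> real \<Rightarrow> real \<Rightarrow> real set \<Rightarrow> (real \<Rightarrow> real) \<Rightarrow> bool" where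
  "ivp_solution h s y0 I x \<longleftrightarrow> open I \<and> is_interval I \<and> s \<in> I \<and> x s = y0 \<and>
     (\<forall>t\<in>I. (x has_real_derivative h t (x t)) (at t))"

definition max_interval :: "(real \<Rightarrow> real \<Rightarrow> real) \<Rightarrow> real \<Rightarrow> real \<Rightarrow> real set" where
  "max_interval h s y0 = \<Union>{I. \<exists>x. ivp_solution h s y0 I x}"

definition max_solution :: "(real \<Rightarrow> real \<Rightarrow> real) \<Rightarrow> real \<Rightarrow> real \<Rightarrow> real \<Rightarrow> real" where
  "max_solution h t s y0 = (THE v. \<exists>I x. ivp_solution h s y0 I x \<and> t \<in> I \<and> v = x t)"

definition q :: "real \<Rightarrow> real \<Rightarrow> real" where
  "q c t = 2 * c / (pi * (c\<^sup>2 * t\<^sup>2 + 1))"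

definition lambda_star :: "(real \<Rightarrow> real) \<Rightarrow> real \<Rightarrow> real" where
  "lambda_star p c = (THE l. \<forall>m.
     (\<exists>x. bounded_solution (\<lambda>t x. - x\<^sup>2 + p t - q c t + m) x) \<longleftrightarrow> m \<ge> l)"

definition E :: "(real \<Rightarrow> real) \<Rightarrow> real \<Rightarrow> real \<Rightarrow> real \<Rightarrow> real" where
  "E p c t y = - (y - 2 / pi * arctan (c * t))\<^sup>2 + p t"

text \<open>The condition \<open>\<delta>0 \<le> c0\<close> keeps \<open>c\<close> in the domain \<open>[0, \<infinity>)\<close> of \<open>\<lambda>\<^sub>*\<close>; it is no
  restriction, since \<open>\<delta>0\<close> can always be decreased.\<close>

definition transversal_tipping :: "(real \<Rightarrow> real) \<Rightarrow> real \<Rightarrow> bool" where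
  "transversal_tipping p c0 \<longleftrightarrow> lambda_star p c0 = 0 \<and>
     (\<exists>\<delta>0>0. \<delta>0 \<le> c0 \<and>
        (\<forall>c\<in>{c0 - \<delta>0..<c0}. lambda_star p c < 0) \<and>
        (\<forall>c\<in>{c0<..c0 + \<delta>0}. lambda_star p c > 0))"

definition bounded_above_left :: "(real \<Rightarrow> real) \<Rightarrow> real \<Rightarrow> real \<Rightarrow> real \<Rightarrow> bool" where
  "bounded_above_left p c s y0 \<longleftrightarrow>
     bdd_above ((\<lambda>t. max_solution (E p c) t s y0) ` (max_interval (E p c) s y0 \<inter> {..s}))"

definition bounded_below_right :: "(real \<Rightarrow> real) \<Rightarrow> real \<Rightarrow> real \<Rightarrow> real \<Rightarrow> bool" where
  "bounded_below_right p c s y0 \<longleftrightarrow>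
     bdd_below ((\<lambda>t. max_solution (E p c) t s y0) ` (max_interval (E p c) s y0 \<inter> {s..}))"

definition R_minus :: "(real \<Rightarrow> real) \<Rightarrow> real \<Rightarrow> real set" where
  "R_minus p c = {s. \<exists>y0. bounded_above_left p c s y0}"

definition R_plus :: "(real \<Rightarrow> real) \<Rightarrow> real \<Rightarrow> real set" where
  "R_plus p c = {s. \<exists>y0. bounded_below_right p c s y0}"

text \<open>\<open>a_sol p c\<close> and \<open>r_sol p c\<close> are meaningful only on \<open>R_minus p c\<close> and \<open>R_plus p c\<close>.\<close>

definition a_sol :: "(real \<Rightarrow> real) \<Rightarrow> real \<Rightarrow> real \<Rightarrow> real" where
  "a_sol p c s = (GREATEST y0. bounded_above_left p c s y0)"

definition r_sol :: "(real \<Rightarrow> real) \<Rightarrow> real \<Rightarrow> real \<Rightarrow> real" where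
  "r_sol p c s = (LEAST y0. bounded_below_right p c s y0)"

text \<open>Uniform convergence on half-lines includes that the half-line eventually lies in the
  \<open>c\<close>-dependent domain; \<open>F\<close> is a filter of parameters \<open>c\<close>.\<close>

definition a_tendsto_neg_half_lines ::
    "(real \<Rightarrow> real) \<Rightarrow> (real \<Rightarrow> real) \<Rightarrow> real filter \<Rightarrow> bool" where
  "a_tendsto_neg_half_lines p b F \<longleftrightarrow>
     (\<forall>k. (\<forall>\<^sub>F c in F. {..k} \<subseteq> R_minus p c) \<and> uniform_limit {..k} (a_sol p) b F)"

definition r_tendsto_pos_half_lines ::
    "(real \<Rightarrow> real) \<Rightarrow> (real \<Rightarrow> real) \<Rightarrow> real filter \<Rightarrow> bool" where
  "r_tendsto_pos_half_lines p b F \<longleftrightarrow>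
     (\<forall>k. (\<forall>\<^sub>F c in F. {k..} \<subseteq> R_plus p c) \<and> uniform_limit {k..} (r_sol p) b F)"

end

theory Submission
  imports Defs
begin

text \<open>In the coordinate \<open>x = y - (2/\<pi>) arctan (c t)\<close> the equation \<open>E\<^sub>c\<close> becomes the Riccati
equation \<open>x' = -x\<^sup>2 + h\<^sub>c(t)\<close> with \<open>h\<^sub>c = p - q\<^sub>c\<close>, and \<open>h\<^sub>c\<close> depends on \<open>c\<close> uniformly in
\<open>t\<close>: \<open>\<bar>q\<^sub>c - q\<^bsub>c'\<^esub>\<bar> \<le> \<bar>c - c'\<bar>\<close>.

A Riccati solution is a quotient \<open>x = u'/u\<close> of a solution of the linear equation \<open>u'' = h u\<close>, and
it lives exactly as long as \<open>u\<close> stays positive. All solutions of the linear equation are global,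
so existence on maximal intervals, blow-up and passage to limits turn into statements about the sign
of \<open>u\<close>. In particular \<open>s \<in> R\<^sup>-\<^sub>c\<close> means that some solution with \<open>u(s) = 1\<close> is positive on
\<open>(-\<infinity>, s]\<close>, and \<open>\<aa>\<^sub>c(s)\<close> is the largest slope \<open>u'(s)\<close> of such a solution (\<open>amax\<close>), up to the
shift by the arctangent.

The engine is the algebraic identity that for two solutions \<open>x\<^sub>1 > x\<^sub>2\<close> of the same equation the
combination \<open>v = (1-\<theta>) x\<^sub>1 + \<theta> x\<^sub>2\<close> satisfies \<open>v' = -v\<^sup>2 + h - \<theta>(1-\<theta>)(x\<^sub>1-x\<^sub>2)\<^sup>2\<close>. If
\<open>x\<^sub>1 - x\<^sub>2 \<ge> \<epsilon>\<close>, then \<open>v\<close> is a lower solution (\<open>0 < \<theta> < 1\<close>) or an upper solution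
(\<open>\<theta> < 0\<close>) with a uniform margin, hence also for every nearby coefficient. So the upper solution of a
uniformly separated pair persists under small perturbations of \<open>h\<close>, uniformly on half-lines
(\<open>amax_perturbation\<close>); no convergence as \<open>t \<rightarrow> -\<infinity>\<close> has to be discussed.

The two hyperbolic solutions of \<open>x' = -x\<^sup>2 + p\<close> are uniformly separated
(\<open>hyperbolic_pair_separated\<close>). As \<open>q\<^sub>c \<rightarrow> 0\<close> at \<open>\<plusminus>\<infinity>\<close>, the equation for \<open>c\<close> inherits this near
\<open>-\<infinity>\<close>: its maximal solution keeps a positive distance on every half-line \<open>(-\<infinity>, k]\<close> from any
solution below it (\<open>amax_separated\<close>). Two consequences give the theorem.

\<^item> At \<open>c\<^sub>0\<close> the maximal and minimal bounded solutions coincide (\<open>amax_eq_at_threshold\<close>): otherwise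
  they would be uniformly separated on \<open>\<real>\<close> and their mean would be a lower solution for \<open>h - m\<close>
  with some \<open>m > 0\<close>, so \<open>\<lambda>\<^sub>*(c\<^sub>0) < 0\<close>. Hence \<open>\<aa>\<^bsub>c\<^sub>0\<^esub> = \<bb>\<^bsub>c\<^sub>0\<^esub>\<close>.

\<^item> On \<open>(-\<infinity>, k]\<close> the solution \<open>\<bb>\<^bsub>c\<^sub>0\<^esub>\<close> is uniformly separated from the solution that starts one unit
  below it at \<open>k\<close>, so the perturbation lemma applies to this pair: for \<open>c\<close> near \<open>c\<^sub>0\<close>, on either side,
  the half-line lies in \<open>R\<^sup>-\<^sub>c\<close> and \<open>\<aa>\<^sub>c\<close> is uniformly close to \<open>\<bb>\<^bsub>c\<^sub>0\<^esub>\<close> there (\<open>a_tendsto\<close>). This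
  also forces \<open>sup R\<^sup>-\<^sub>c \<rightarrow> \<infinity>\<close>.

The statements on \<open>\<rr>\<^sub>c\<close> and \<open>R\<^sup>+\<^sub>c\<close> follow from those on \<open>\<aa>\<^sub>c\<close> and \<open>R\<^sup>-\<^sub>c\<close> by the reflection
\<open>(t, y) \<mapsto> (-t, -y)\<close>, which replaces \<open>p(t)\<close> by \<open>p(-t)\<close>.\<close>

section \<open>Linear comparison on an interval\<close>

lemma antiderivative_exists:
  fixes f :: "real \<Rightarrow> real"
  assumes "continuous_on UNIV f"
  obtains F where "F s = 0" "\<And>t. (F has_real_derivative f t) (at t)"
proof -
  have "isCont f x" for x
    using assms by (simp add: continuous_on_eq_continuous_at)
  with einterval_antiderivative[of "-\<infinity>" "\<infinity>" f]
  obtain F where F: "\<And>x. (F has_real_derivative f x) (at x)"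
    by (auto simp: has_real_derivative_iff_has_vector_derivative)
  show ?thesis
    by (rule that[of "\<lambda>t. F t - F s"]) (auto intro!: derivative_eq_intros F)
qed

text \<open>The integrating factor \<open>exp (- \<integral> g)\<close> makes \<open>w\<close> monotone. The constant is left anonymous because
only its sign matters below: a linear differential inequality propagates signs.\<close>

lemma linear_inequality:
  fixes g w :: "real \<Rightarrow> real"
  assumes "a \<le> b" and g: "continuous_on {a..b} g"
    and w: "\<And>t. t \<in> {a..b} \<Longrightarrow> (w has_real_derivative w' t) (at t)"
    and ineq: "\<And>t. t \<in> {a..b} \<Longrightarrow> w' t \<ge> g t * w t"
  obtains C where "C > 0" "w b \<ge> C * w a"
proof -
  obtain G where G: "\<And>t. t \<in> {a..b} \<Longrightarrow> (G has_real_derivative g t) (at t within {a..b})"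
    using antiderivative_continuous[OF g] by (metis has_real_derivative_iff_has_vector_derivative)
  define F where "F t = w t * exp (- G t)" for t
  have "continuous_on {a..b} G"
    using G by (rule DERIV_continuous_on)
  moreover have "continuous_on {a..b} w"
    by (rule DERIV_continuous_on[of _ _ w']) (use w in \<open>blast intro: DERIV_subset\<close>)
  ultimately have cont: "continuous_on {a..b} F"
    unfolding F_def by (intro continuous_intros)
  have "F a \<le> F b"
  proof (rule DERIV_nonneg_imp_increasing_open[OF \<open>a \<le> b\<close> _ cont])
    fix t assume t: "a < t" "t < b"
    then have Gt: "(G has_real_derivative g t) (at t)"
      using G[of t] at_within_Icc_at[of a t b] by auto
    have "(F has_real_derivative (w' t - g t * w t) * exp (- G t)) (at t)"
      unfolding F_def using t
      by (auto intro!: derivative_eq_intros Gt w simp: algebra_simps)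
    then show "\<exists>y. (F has_real_derivative y) (at t) \<and> 0 \<le> y"
      using ineq[of t] t by fastforce
  qed
  then have "w b \<ge> exp (G b - G a) * w a"
    by (simp add: F_def exp_diff exp_minus field_simps)
  then show ?thesis using that[of "exp (G b - G a)"] by simp
qed

lemma linear_inequality_sign:
  fixes g w :: "real \<Rightarrow> real"
  assumes "a \<le> b" "continuous_on {a..b} g"
    "\<And>t. t \<in> {a..b} \<Longrightarrow> (w has_real_derivative w' t) (at t)"
    "\<And>t. t \<in> {a..b} \<Longrightarrow> w' t \<ge> g t * w t"
  shows "w b \<le> 0 \<Longrightarrow> w a \<le> 0" "w b < 0 \<Longrightarrow> w a < 0"
proof -
  obtain C where C: "C > 0" "w b \<ge> C * w a" by (rule linear_inequality[OF assms])
  show "w a \<le> 0" if "w b \<le> 0"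
    using that C mult_pos_pos[of C "w a"] by linarith
  show "w a < 0" if "w b < 0"
    using that C mult_nonneg_nonneg[of C "w a"] by linarith
qed

text \<open>Differences of Riccati solutions satisfy a linear equation, so this is the source of both uniqueness
and the fact that solutions do not cross.\<close>

lemma linear_equality:
  fixes g w :: "real \<Rightarrow> real"
  assumes "a \<le> b" and g: "continuous_on {a..b} g"
    and w: "\<And>t. t \<in> {a..b} \<Longrightarrow> (w has_real_derivative g t * w t) (at t)"
  shows "sgn (w a) = sgn (w b)"
proof -
  obtain C where C: "C > 0" "w b \<ge> C * w a"
    by (rule linear_inequality[OF assms]) auto
  have nw: "((\<lambda>t. - w t) has_real_derivative g t * - w t) (at t)" if "t \<in> {a..b}" for t
    using w[OF that] by (auto intro!: derivative_eq_intros)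
  obtain D where D: "D > 0" "- w b \<ge> D * - w a"
    by (rule linear_inequality[OF \<open>a \<le> b\<close> g nw]) auto
  consider "w a > 0" | "w a = 0" | "w a < 0" by linarith
  then show ?thesis
  proof cases
    case 1
    then have "w b > 0" using C mult_pos_pos[of C "w a"] by linarith
    with 1 show ?thesis by simp
  next
    case 2 then show ?thesis using C D by (simp add: sgn_if)
  next
    case 3
    then have "w b < 0" using D mult_pos_neg[of D "w a"] by linarith
    with 3 show ?thesis by simp
  qed
qed

section \<open>The second-order linear equation\<close>

definition bcont :: "(real \<Rightarrow> real) \<Rightarrow> bool" where
  "bcont h \<longleftrightarrow> continuous_on UNIV h \<and> bounded (range h)"

lemma bcontE:
  assumes "bcont h" obtains K where "K \<ge> 0" "\<And>t. \<bar>h t\<bar> \<le> K"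
proof -
  obtain B where "\<And>t. norm (h t) \<le> B"
    using assms unfolding bcont_def bounded_iff by auto
  then show ?thesis using that[of "max 0 B"] by (simp add: max.coboundedI2)
qed

lemma bcontI:
  assumes "continuous_on UNIV h" "\<And>t. \<bar>h t\<bar> \<le> K" shows "bcont h"
  using assms unfolding bcont_def bounded_iff by auto

lemma bcont_add_const:
  assumes "bcont h" shows "bcont (\<lambda>t. h t + m)"
proof -
  obtain K where "\<And>t. \<bar>h t\<bar> \<le> K" using bcontE[OF assms] by blast
  then show ?thesis using assms
    by (intro bcontI[of _ "K + \<bar>m\<bar>"])
      (auto simp: bcont_def intro!: continuous_intros order_trans[OF abs_triangle_ineq])
qed

lemma bcont_reflect: "bcont h \<Longrightarrow> bcont (\<lambda>t. h (- t))"
  unfolding bcont_def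
  by (auto intro!: continuous_on_compose2[of UNIV h _ uminus] continuous_intros
      elim: bounded_subset)

text \<open>The equation \<open>u'' = h u\<close> as a first-order system, with \<open>v = u'\<close>.\<close>

definition lin :: "(real \<Rightarrow> real) \<Rightarrow> (real \<Rightarrow> real) \<Rightarrow> (real \<Rightarrow> real) \<Rightarrow> bool" where
  "lin h u v \<longleftrightarrow> (\<forall>t. (u has_real_derivative v t) (at t) \<and> (v has_real_derivative h t * u t) (at t))"

text \<open>Integration from \<open>s\<close> has norm at most \<open>1/L\<close> for the weight \<open>exp (L \<bar>t - s\<bar>)\<close>. This makes Picard
iteration contract on the whole line at once.\<close>

lemma antiderivative_exp_bound:
  fixes F f :: "real \<Rightarrow> real"
  assumes F: "F s = 0" "\<And>t. (F has_real_derivative f t) (at t)" and L: "L > 0"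
    and f: "\<And>t. \<bar>f t\<bar> \<le> A * exp (L * \<bar>t - s\<bar>)"
  shows "\<bar>F t\<bar> \<le> A / L * exp (L * \<bar>t - s\<bar>)"
proof -
  have A: "A \<ge> 0" using f[of s] by simp
  have "\<sigma> * F t \<le> A / L * exp (L * \<bar>t - s\<bar>)" if "\<bar>\<sigma>\<bar> = 1" for \<sigma>
  proof (cases "t \<ge> s")
    case True
    define G where "G \<tau> = A / L * exp (L * (\<tau> - s)) - \<sigma> * F \<tau>" for \<tau>
    have "G s \<le> G t"
    proof (rule DERIV_nonneg_imp_nondecreasing[OF True])
      fix \<tau> assume \<tau>: "s \<le> \<tau>" "\<tau> \<le> t"
      have "(G has_real_derivative A * exp (L * (\<tau> - s)) - \<sigma> * f \<tau>) (at \<tau>)"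
        unfolding G_def using L by (auto intro!: derivative_eq_intros F simp: field_simps)
      moreover have "\<sigma> * f \<tau> \<le> \<bar>f \<tau>\<bar>" using that by (auto simp: abs_if split: if_splits)
      ultimately show "\<exists>y. (G has_real_derivative y) (at \<tau>) \<and> 0 \<le> y"
        using f[of \<tau>] \<tau> by fastforce
    qed
    moreover have "G s \<ge> 0" using A L F by (simp add: G_def)
    ultimately show ?thesis using True by (simp add: G_def)
  next
    case False
    define G where "G \<tau> = A / L * exp (L * (s - \<tau>)) - \<sigma> * F \<tau>" for \<tau>
    have "G s \<le> G t"
    proof (rule DERIV_nonpos_imp_nonincreasing[of t s])
      show "t \<le> s" using False by simp
      fix \<tau> assume \<tau>: "t \<le> \<tau>" "\<tau> \<le> s"
      have "(G has_real_derivative - A * exp (L * (s - \<tau>)) - \<sigma> * f \<tau>) (at \<tau>)"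
        unfolding G_def using L by (auto intro!: derivative_eq_intros F simp: field_simps)
      moreover have "- (\<sigma> * f \<tau>) \<le> \<bar>f \<tau>\<bar>" using that by (auto simp: abs_if split: if_splits)
      ultimately show "\<exists>y. (G has_real_derivative y) (at \<tau>) \<and> y \<le> 0"
        using f[of \<tau>] \<tau> by fastforce
    qed
    moreover have "G s \<ge> 0" using A L F by (simp add: G_def)
    ultimately show ?thesis using False by (simp add: G_def)
  qed
  from this[of 1] this[of "-1"] show ?thesis by simp
qed

definition antideriv :: "real \<Rightarrow> (real \<Rightarrow> real) \<Rightarrow> real \<Rightarrow> real" where
  "antideriv s f = (SOME F. F s = 0 \<and> (\<forall>t. (F has_real_derivative f t) (at t)))"

lemma antideriv:
  assumes "continuous_on UNIV f"
  shows "antideriv s f s = 0" "(antideriv s f has_real_derivative f t) (at t)"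
proof -
  have "\<exists>F. F s = 0 \<and> (\<forall>t. (F has_real_derivative f t) (at t))"
    using antiderivative_exists[OF assms, of s] by blast
  from someI_ex[OF this] show "antideriv s f s = 0" "(antideriv s f has_real_derivative f t) (at t)"
    unfolding antideriv_def by auto
qed

primrec picard :: "(real \<Rightarrow> real) \<Rightarrow> real \<Rightarrow> real \<Rightarrow> real \<Rightarrow> nat \<Rightarrow> (real \<Rightarrow> real) \<times> (real \<Rightarrow> real)" where
  "picard h s \<alpha> \<beta> 0 = (\<lambda>_. \<alpha>, \<lambda>_. \<beta>)"
| "picard h s \<alpha> \<beta> (Suc n) =
    (antideriv s (snd (picard h s \<alpha> \<beta> n)), antideriv s (\<lambda>t. h t * fst (picard h s \<alpha> \<beta> n) t))"

text \<open>The solution is the sum of the Picard increments. With \<open>L = 2 (1 + K)\<close> each increment is at most half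
of the previous one in the weighted norm, so the series and its termwise derivative converge uniformly
on compact intervals.\<close>

lemma lin_exists:
  assumes "bcont h"
  obtains u v where "lin h u v" "u s = \<alpha>" "v s = \<beta>"
proof -
  obtain K where K: "K \<ge> 0" "\<And>t. \<bar>h t\<bar> \<le> K" using bcontE[OF assms] by blast
  define u where "u n = fst (picard h s \<alpha> \<beta> n)" for n
  define v where "v n = snd (picard h s \<alpha> \<beta> n)" for n
  have hc: "continuous_on UNIV h" using assms by (simp add: bcont_def)
  have rec: "u 0 = (\<lambda>_. \<alpha>)" "v 0 = (\<lambda>_. \<beta>)" "u (Suc n) = antideriv s (v n)"
    "v (Suc n) = antideriv s (\<lambda>t. h t * u n t)" for n
    by (simp_all add: u_def v_def)
  have cont: "continuous_on UNIV (u n) \<and> continuous_on UNIV (v n)" for n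
  proof (induction n)
    case 0 show ?case by (simp add: rec)
  next
    case (Suc n)
    then have hu: "continuous_on UNIV (\<lambda>t. h t * u n t)" using hc by (auto intro: continuous_intros)
    have "continuous_on UNIV (antideriv s (v n))"
      using Suc by (auto intro!: DERIV_continuous_on[OF has_field_derivative_at_within[OF antideriv(2)]])
    moreover have "continuous_on UNIV (antideriv s (\<lambda>t. h t * u n t))"
      using hu by (intro DERIV_continuous_on[OF has_field_derivative_at_within[OF antideriv(2)]])
    ultimately show ?case unfolding rec by blast
  qed
  have hu: "continuous_on UNIV (\<lambda>t. h t * u n t)" for n
    using cont[of n] hc by (auto intro: continuous_intros)
  have uS: "u (Suc n) s = 0" "(u (Suc n) has_real_derivative v n t) (at t)" for n t
    using antideriv[of "v n"] cont[of n] unfolding rec by auto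
  have vS: "v (Suc n) s = 0" "(v (Suc n) has_real_derivative h t * u n t) (at t)" for n t
    using antideriv[OF hu[of n]] unfolding rec by auto
  define L where "L = 2 * (1 + K)"
  have L: "L > 0" "1 / L \<le> 1/2" "K / L \<le> 1/2" using K by (auto simp: L_def field_simps)
  define C where "C = max \<bar>\<alpha>\<bar> \<bar>\<beta>\<bar>"
  have C: "C \<ge> 0" by (simp add: C_def)
  define W where "W t = exp (L * \<bar>t - s\<bar>)" for t
  have W: "W t \<ge> 1" for t using L by (simp add: W_def)
  have bd: "\<bar>u n t\<bar> \<le> C * (1/2)^n * W t \<and> \<bar>v n t\<bar> \<le> C * (1/2)^n * W t" for n t
  proof (induction n arbitrary: t)
    case 0
    have "C * 1 \<le> C * W t" using C W[of t] by (rule mult_left_mono[rotated])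
    then show ?case by (auto simp: rec C_def)
  next
    case (Suc n)
    have "\<bar>u (Suc n) t\<bar> \<le> (C * (1/2)^n) / L * W t"
      unfolding W_def by (rule antiderivative_exp_bound[OF uS L(1)]) (use Suc in \<open>auto simp: W_def\<close>)
    also have "\<dots> = (C * (1/2)^n * W t) * (1 / L)" by simp
    also have "\<dots> \<le> (C * (1/2)^n * W t) * (1 / 2)"
      using C W[of t] L by (intro mult_left_mono) auto
    finally have 1: "\<bar>u (Suc n) t\<bar> \<le> C * (1/2)^Suc n * W t" by simp
    have "\<bar>v (Suc n) t\<bar> \<le> (K * (C * (1/2)^n)) / L * W t"
      unfolding W_def
    proof (rule antiderivative_exp_bound[OF vS L(1)])
      fix t show "\<bar>h t * u n t\<bar> \<le> K * (C * (1/2)^n) * exp (L * \<bar>t - s\<bar>)"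
        using mult_mono[OF K(2)[of t] conjunct1[OF Suc[of t]]] K by (simp add: abs_mult W_def mult.assoc)
    qed
    also have "\<dots> = (C * (1/2)^n * W t) * (K / L)" by simp
    also have "\<dots> \<le> (C * (1/2)^n * W t) * (1 / 2)"
      using C W[of t] L by (intro mult_left_mono) auto
    finally show ?case using 1 by simp
  qed
  have sums: "summable (\<lambda>n. u n t)" "summable (\<lambda>n. v n t)" for t
  proof -
    have "summable (\<lambda>n. C * (1/2)^n * W t)" by (intro summable_mult summable_mult2 summable_geometric) auto
    then show "summable (\<lambda>n. u n t)" "summable (\<lambda>n. v n t)"
      by (rule summable_comparison_test'[of _ 0]; use bd in auto)+
  qed
  have unif: "uniformly_convergent_on {s-R..s+R} (\<lambda>n t. \<Sum>i<n. f i t)"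
    if f: "\<And>n t. \<bar>f n t\<bar> \<le> B * (1/2)^n * W t" and B: "B \<ge> 0" for R B and f :: "nat \<Rightarrow> real \<Rightarrow> real"
  proof (rule Weierstrass_m_test')
    show "summable (\<lambda>n. B * (1/2)^n * exp (L * R))" by (intro summable_mult summable_mult2 summable_geometric) auto
    fix n t assume "t \<in> {s-R..s+R}"
    then have "W t \<le> exp (L * R)" using L by (auto simp: W_def abs_if)
    then have "B * (1/2)^n * W t \<le> B * (1/2)^n * exp (L * R)" using B by (intro mult_left_mono) auto
    then show "norm (f n t) \<le> B * (1/2)^n * exp (L * R)" using f[of n t] by simp
  qed
  have termwise: "((\<lambda>t. \<Sum>n. F n t) has_real_derivative (\<Sum>n. f n t)) (at t)"
    if F: "\<And>n t. (F n has_real_derivative f n t) (at t)" and "\<And>t. summable (\<lambda>n. F n t)"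
      and f: "\<And>n t. \<bar>f n t\<bar> \<le> B * (1/2)^n * W t" and B: "B \<ge> 0" for f F B t
  proof (rule has_field_derivative_series'(2)[where S = "{s - (\<bar>t - s\<bar> + 1)..s + (\<bar>t - s\<bar> + 1)}" and ?x0.0 = s])
    show "uniformly_convergent_on {s - (\<bar>t - s\<bar> + 1)..s + (\<bar>t - s\<bar> + 1)} (\<lambda>n x. \<Sum>i<n. f i x)"
      by (rule unif[OF f B])
  qed (use that in \<open>auto intro: has_field_derivative_at_within\<close>)
  \<comment> \<open>The derivative of the n-th increment is determined by increment n - 1; shift the series accordingly.\<close>
  define dz where "dz f n = (case n of 0 \<Rightarrow> \<lambda>_. 0 | Suc m \<Rightarrow> f m)" for f :: "nat \<Rightarrow> real \<Rightarrow> real" and n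
  have dzsum: "(\<Sum>n. dz f n t) = (\<Sum>n. f n t)" if "summable (\<lambda>n. f n t)" for f t
  proof -
    have "(\<lambda>n. dz f n t) sums ((\<Sum>n. f n t) + dz f 0 t)"
      by (subst sums_Suc_iff[symmetric]) (use that in \<open>simp add: dz_def summable_sums\<close>)
    then show ?thesis by (simp add: dz_def sums_iff)
  qed
  have dzb: "\<bar>dz f n t\<bar> \<le> 2 * B * (1/2)^n * W t" if "\<And>n t. \<bar>f n t\<bar> \<le> B * (1/2)^n * W t" "B \<ge> 0" for f B n t
    using that W[of t] by (cases n) (auto simp: dz_def)
  have "((\<lambda>t. \<Sum>n. u n t) has_real_derivative (\<Sum>n. dz v n t)) (at t)" for t
  proof (rule termwise[where B = "2 * C"])
    fix n t show "(u n has_real_derivative dz v n t) (at t)"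
      by (cases n) (auto simp: dz_def uS, simp add: rec)
  qed (use sums C dzb[where f=v and B=C] bd in auto)
  then have du: "((\<lambda>t. \<Sum>n. u n t) has_real_derivative (\<Sum>n. v n t)) (at t)" for t
    using dzsum[OF sums(2)] by simp
  have hub: "\<bar>h t * u n t\<bar> \<le> (K * C) * (1/2)^n * W t" for n t
    using mult_mono[OF K(2)[of t] conjunct1[OF bd[of n t]]] K by (simp add: abs_mult mult.assoc)
  have "((\<lambda>t. \<Sum>n. v n t) has_real_derivative (\<Sum>n. dz (\<lambda>n t. h t * u n t) n t)) (at t)" for t
  proof (rule termwise[where B = "2 * (K * C)"])
    fix n t show "(v n has_real_derivative dz (\<lambda>n t. h t * u n t) n t) (at t)"
      by (cases n) (auto simp: dz_def vS rec(2))
    show "\<bar>dz (\<lambda>n t. h t * u n t) n t\<bar> \<le> 2 * (K * C) * (1/2)^n * W t"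
      by (rule dzb[OF hub]) (use K C in auto)
  qed (use sums C K in auto)
  note dv0 = this
  have dv: "((\<lambda>t. \<Sum>n. v n t) has_real_derivative h t * (\<Sum>n. u n t)) (at t)" for t
  proof -
    have "(\<Sum>n. dz (\<lambda>n t. h t * u n t) n t) = h t * (\<Sum>n. u n t)"
      using dzsum[of "\<lambda>n t. h t * u n t" t] sums(1)[of t] by (simp add: summable_mult suminf_mult)
    with dv0[of t] show ?thesis by metis
  qed
  have at_s: "(\<Sum>n. f n) = f 0" if "\<And>n. f (Suc n) = 0" for f :: "nat \<Rightarrow> real"
    by (subst suminf_finite[of "{0}"]) (use that in \<open>auto simp: gr0_conv_Suc\<close>)
  show ?thesis
  proof (rule that[of "\<lambda>t. \<Sum>n. u n t" "\<lambda>t. \<Sum>n. v n t"])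
    show "(\<Sum>n. u n s) = \<alpha>" by (subst at_s) (use uS in \<open>auto simp: rec\<close>)
    show "(\<Sum>n. v n s) = \<beta>" by (subst at_s) (use vS in \<open>auto simp: rec\<close>)
  qed (use du dv in \<open>simp add: lin_def\<close>)
qed

text \<open>Time reversal. It is used throughout to obtain statements about the past from those about the
future.\<close>

lemma lin_reflect:
  assumes "lin h u v" shows "lin (\<lambda>t. h (- t)) (\<lambda>t. u (- t)) (\<lambda>t. - v (- t))"
proof -
  have u: "(u has_real_derivative v t) (at t)" and v: "(v has_real_derivative h t * u t) (at t)" for t
    using assms by (auto simp: lin_def)
  have "((\<lambda>t. u (- t)) has_real_derivative - v (- t)) (at t)" for t
    using u[of "- t"] by (simp add: DERIV_mirror)
  moreover have "((\<lambda>t. - v (- t)) has_real_derivative h (- t) * u (- t)) (at t)" for t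
    using v[of "- t"] DERIV_minus by (fastforce simp: DERIV_mirror)
  ultimately show ?thesis by (simp add: lin_def)
qed

text \<open>Gronwall for \<open>u\<^sup>2 + v\<^sup>2\<close>. With \<open>f = 0\<close> it gives uniqueness; with an error term \<open>f\<close> it gives
continuous dependence on the coefficient.\<close>

lemma energy_estimate:
  fixes u v :: "real \<Rightarrow> real"
  assumes u: "\<And>t. (u has_real_derivative v t) (at t)"
    and v: "\<And>t. (v has_real_derivative h t * u t + f t) (at t)"
    and init: "u s = 0" "v s = 0" and h: "\<And>t. \<bar>h t\<bar> \<le> K" and "s \<le> e"
    and f: "\<And>t. s \<le> t \<Longrightarrow> t \<le> e \<Longrightarrow> \<bar>f t\<bar> \<le> \<eta>"
  shows "(u e)\<^sup>2 + (v e)\<^sup>2 \<le> \<eta>\<^sup>2 * (e - s) * exp ((2 + K) * (e - s))"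
proof -
  define L where "L = 2 + K"
  have L: "L \<ge> 0" using h[of 0] by (simp add: L_def)
  define F where "F t = ((u t)\<^sup>2 + (v t)\<^sup>2) * exp (- L * (t - s)) - \<eta>\<^sup>2 * (t - s)" for t
  have "F s \<ge> F e"
  proof (rule DERIV_nonpos_imp_nonincreasing[OF \<open>s \<le> e\<close>])
    fix t assume t: "s \<le> t" "t \<le> e"
    let ?D = "2 * u t * v t + 2 * v t * (h t * u t + f t)"
    have "(F has_real_derivative (?D - L * ((u t)\<^sup>2 + (v t)\<^sup>2)) * exp (- L * (t - s)) - \<eta>\<^sup>2) (at t)"
      unfolding F_def by (auto intro!: derivative_eq_intros u v simp: algebra_simps power2_eq_square)
    moreover have "(?D - L * ((u t)\<^sup>2 + (v t)\<^sup>2)) * exp (- L * (t - s)) \<le> \<eta>\<^sup>2"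
    proof -
      have sq: "2 * \<bar>u t\<bar> * \<bar>v t\<bar> \<le> (u t)\<^sup>2 + (v t)\<^sup>2"
        using zero_le_power2[of "\<bar>u t\<bar> - \<bar>v t\<bar>"] by (simp add: power2_diff)
      have fe: "(f t)\<^sup>2 \<le> \<eta>\<^sup>2" using f[OF t] by (metis abs_le_square_iff abs_ge_self order_trans abs_of_nonneg abs_ge_zero)
      have "2 * u t * v t * (1 + h t) \<le> (2 * \<bar>u t\<bar> * \<bar>v t\<bar>) * \<bar>1 + h t\<bar>"
        by (rule order_trans[OF abs_ge_self]) (simp add: abs_mult)
      also have "\<dots> \<le> ((u t)\<^sup>2 + (v t)\<^sup>2) * (1 + K)"
        using sq h[of t] by (intro mult_mono) (auto simp: abs_if split: if_splits)
      finally have 1: "2 * u t * v t * (1 + h t) \<le> ((u t)\<^sup>2 + (v t)\<^sup>2) * (1 + K)" .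
      have 2: "2 * v t * f t \<le> (v t)\<^sup>2 + (f t)\<^sup>2"
        using zero_le_power2[of "v t - f t"] by (simp add: power2_diff)
      have "?D - L * ((u t)\<^sup>2 + (v t)\<^sup>2) \<le> \<eta>\<^sup>2 - (u t)\<^sup>2"
        using 1 2 fe by (simp add: L_def algebra_simps)
      also have "\<dots> \<le> \<eta>\<^sup>2" by simp
      finally have 3: "?D - L * ((u t)\<^sup>2 + (v t)\<^sup>2) \<le> \<eta>\<^sup>2" .
      have "exp (- L * (t - s)) \<le> 1" using L t by simp
      then have "\<eta>\<^sup>2 * exp (- L * (t - s)) \<le> \<eta>\<^sup>2" by (simp add: mult_left_le)
      moreover have "(?D - L * ((u t)\<^sup>2 + (v t)\<^sup>2)) * exp (- L * (t - s)) \<le> \<eta>\<^sup>2 * exp (- L * (t - s))"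
        using 3 by (intro mult_right_mono) auto
      ultimately show ?thesis by linarith
    qed
    ultimately show "\<exists>y. (F has_real_derivative y) (at t) \<and> y \<le> 0" by (meson diff_le_0_iff_le)
  qed
  then have "((u e)\<^sup>2 + (v e)\<^sup>2) / exp (L * (e - s)) \<le> \<eta>\<^sup>2 * (e - s)"
    using init by (simp add: F_def exp_minus divide_inverse)
  then show ?thesis by (simp add: L_def pos_divide_le_eq)
qed

lemma lin_zero:
  assumes "bcont h" "lin h u v" "u s = 0" "v s = 0"
  shows "u t = 0 \<and> v t = 0"
proof -
  have right: "u t = 0 \<and> v t = 0"
    if h: "bcont h" and l: "lin h u v" and i: "u s = 0" "v s = 0" and "s \<le> t" for h u v s t
  proof -
    obtain K where K: "\<And>t. \<bar>h t\<bar> \<le> K" using bcontE[OF h] by blast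
    have "(u t)\<^sup>2 + (v t)\<^sup>2 \<le> 0\<^sup>2 * (t - s) * exp ((2 + K) * (t - s))"
      by (rule energy_estimate[where u=u and v=v and h=h and f="\<lambda>_. 0"])
        (use l i K \<open>s \<le> t\<close> in \<open>auto simp: lin_def\<close>)
    then show ?thesis by (simp add: sum_power2_le_zero_iff)
  qed
  show ?thesis
  proof (cases "s \<le> t")
    case True then show ?thesis using right assms by blast
  next
    case False
    then show ?thesis
      using right[OF bcont_reflect[OF assms(1)] lin_reflect[OF assms(2)], of "- s" "- t"] assms by simp
  qed
qed

lemma lin_combine:
  assumes "lin h u v" "lin h u' v'"
  shows "lin h (\<lambda>t. u t + c * u' t) (\<lambda>t. v t + c * v' t)"
  using assms unfolding lin_def by (auto intro!: derivative_eq_intros simp: algebra_simps)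

lemma lin_unique:
  assumes h: "bcont h" and l: "lin h u v" "lin h u' v'" and i: "u s = u' s" "v s = v' s"
  shows "u t = u' t" "v t = v' t"
  using lin_zero[OF h lin_combine[OF l, of "-1"], of s t] i by auto

text \<open>Normalising \<open>u(s) = 1\<close> makes the initial slope \<open>u'(s)\<close> the initial value of the Riccati solution
\<open>u'/u\<close>.\<close>

definition lin_sol :: "(real \<Rightarrow> real) \<Rightarrow> real \<Rightarrow> real \<Rightarrow> (real \<Rightarrow> real) \<times> (real \<Rightarrow> real)" where
  "lin_sol h s x0 = (SOME (u, v). lin h u v \<and> u s = 1 \<and> v s = x0)"

abbreviation "U h s x0 \<equiv> fst (lin_sol h s x0)"
abbreviation "V h s x0 \<equiv> snd (lin_sol h s x0)"

lemma lin_sol: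
  assumes "bcont h"
  shows "lin h (U h s x0) (V h s x0)" "U h s x0 s = 1" "V h s x0 s = x0"
proof -
  obtain u v where "lin h u v \<and> u s = 1 \<and> v s = x0"
    using lin_exists[OF assms, of s 1 x0] by metis
  then have "case (u, v) of (u, v) \<Rightarrow> lin h u v \<and> u s = 1 \<and> v s = x0" by simp
  from someI[of "\<lambda>(u, v). lin h u v \<and> u s = 1 \<and> v s = x0", OF this]
  show "lin h (U h s x0) (V h s x0)" "U h s x0 s = 1" "V h s x0 s = x0"
    by (auto simp: lin_sol_def split: prod.splits)
qed

lemma U_deriv:
  assumes "bcont h"
  shows "(U h s x0 has_real_derivative V h s x0 t) (at t)"
    "(V h s x0 has_real_derivative h t * U h s x0 t) (at t)"
  using lin_sol(1)[OF assms] by (auto simp: lin_def)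

lemma U_reflect:
  assumes "bcont h"
  shows "U (\<lambda>t. h (- t)) (- s) (- x0) (- t) = U h s x0 t"
    "V (\<lambda>t. h (- t)) (- s) (- x0) (- t) = - V h s x0 t"
  using lin_unique[OF bcont_reflect[OF assms] lin_sol(1)[OF bcont_reflect[OF assms]]
      lin_reflect[OF lin_sol(1)[OF assms]], of "- s" "- x0" "- s" s x0 "- t"]
  by (simp_all add: lin_sol[OF assms] lin_sol[OF bcont_reflect[OF assms]])

text \<open>By linearity the initial value enters affinely, so continuity in \<open>x0\<close> is immediate.\<close>

lemma U_affine:
  assumes "bcont h"
  shows "U h s x0 t = U h s 0 t + x0 * (U h s 1 t - U h s 0 t)"
proof -
  have "lin h (\<lambda>t. (U h s 0 t + x0 * U h s 1 t) + (- x0) * U h s 0 t)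
     (\<lambda>t. (V h s 0 t + x0 * V h s 1 t) + (- x0) * V h s 0 t)"
    by (intro lin_combine lin_sol assms)
  from lin_unique(1)[OF assms lin_sol(1)[OF assms] this, of s x0 s]
  show ?thesis by (simp add: lin_sol[OF assms] algebra_simps)
qed

section \<open>Riccati solutions\<close>

text \<open>Two-sided derivatives are required even at end points of \<open>I\<close>; this lets solutions be restricted to
subsets freely and holds for all solutions that occur, as they extend beyond \<open>I\<close>.\<close>

definition riccati :: "(real \<Rightarrow> real) \<Rightarrow> (real \<Rightarrow> real) \<Rightarrow> real set \<Rightarrow> bool" where
  "riccati h x I \<longleftrightarrow> (\<forall>t\<in>I. (x has_real_derivative h t - (x t)\<^sup>2) (at t))"

lemma riccatiD: "riccati h x I \<Longrightarrow> t \<in> I \<Longrightarrow> (x has_real_derivative h t - (x t)\<^sup>2) (at t)"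
  by (simp add: riccati_def)

lemma riccati_subset: "riccati h x I \<Longrightarrow> J \<subseteq> I \<Longrightarrow> riccati h x J"
  by (auto simp: riccati_def)

lemma riccati_continuous: "riccati h x I \<Longrightarrow> continuous_on I x"
  by (rule DERIV_continuous_on[OF has_field_derivative_at_within[OF riccatiD]])

lemma has_derivative_reflect:
  fixes x :: "real \<Rightarrow> real"
  assumes "(x has_real_derivative D) (at (- t))"
  shows "((\<lambda>t. - x (- t)) has_real_derivative D) (at t)"
  using DERIV_minus[OF assms[unfolded DERIV_mirror]] by simp

lemma riccati_reflect:
  assumes "riccati h x I" shows "riccati (\<lambda>t. h (- t)) (\<lambda>t. - x (- t)) (uminus ` I)"
  unfolding riccati_def using assms by (auto intro!: has_derivative_reflect dest: riccatiD)

text \<open>At a first zero \<open>u\<close> would be nonnegative up to that point, which \<open>step\<close> excludes. This replaces an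
argument by continuation of maximal solutions.\<close>

lemma positive_continuation:
  fixes u :: "real \<Rightarrow> real"
  assumes u: "continuous_on {s..e} u" "u s > 0"
    and step: "\<And>t. t \<in> {s..e} \<Longrightarrow> \<forall>\<tau>\<in>{s..t}. u \<tau> \<ge> 0 \<Longrightarrow> u t > 0" and t: "t \<in> {s..e}"
  shows "u t > 0"
proof (rule ccontr)
  assume neg: "\<not> u t > 0"
  define Z where "Z = {\<tau>\<in>{s..t}. u \<tau> \<le> 0}"
  have cont: "continuous_on {s..t} u" using u t by (auto intro: continuous_on_subset)
  have "closed Z" unfolding Z_def
    by (rule continuous_on_closed_Collect_le[OF cont]) (auto intro: continuous_intros)
  moreover have "bounded Z" unfolding Z_def by (rule bounded_subset[OF bounded_closed_interval[of s t]]) auto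
  moreover have "t \<in> Z" using neg t by (simp add: Z_def)
  ultimately obtain z where z: "z \<in> Z" "\<And>\<tau>. \<tau> \<in> Z \<Longrightarrow> z \<le> \<tau>"
    using compact_attains_inf[of Z] by (metis compact_eq_bounded_closed empty_iff)
  have "\<exists>y\<ge>s. y \<le> z \<and> u y = 0"
    by (rule IVT2') (use z u t in \<open>auto simp: Z_def intro: continuous_on_subset[OF cont]\<close>)
  then obtain y where y: "s \<le> y" "y \<le> z" "u y = 0" by blast
  then have "y \<in> Z" using z(1) by (auto simp: Z_def)
  with z(2) y have "u z = 0" by fastforce
  moreover have "u \<tau> \<ge> 0" if "\<tau> \<in> {s..z}" for \<tau>
  proof (cases "\<tau> = z")
    case False
    then have "\<tau> \<notin> Z" using z(2) that by fastforce
    then show ?thesis using that z(1) by (auto simp: Z_def)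
  qed (simp add: \<open>u z = 0\<close>)
  ultimately show False using step[of z] z(1) t by (auto simp: Z_def)
qed

text \<open>While \<open>u \<ge> 0\<close>, the defect \<open>w = u' - v u\<close> satisfies \<open>w' \<ge> - v w\<close> and \<open>w(s) \<ge> 0\<close>; hence \<open>w \<ge> 0\<close>,
that is \<open>u' \<ge> v u\<close>, and this in turn keeps \<open>u\<close> positive. So a Riccati solution that starts above a
lower solution cannot blow up as long as the lower solution exists.\<close>

lemma lower_solution_right:
  assumes h: "bcont h" and v: "\<And>t. t \<in> {s..e} \<Longrightarrow> (v has_real_derivative v' t) (at t)"
    and le: "\<And>t. t \<in> {s..e} \<Longrightarrow> v' t \<le> h t - (v t)\<^sup>2" and x0: "v s \<le> x0" and t: "t \<in> {s..e}"
  shows "U h s x0 t > 0 \<and> v t * U h s x0 t \<le> V h s x0 t"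
proof -
  note d = U_deriv[OF h, of s x0] and i = lin_sol(2,3)[OF h, of s x0]
  have vc: "continuous_on {s..e} v"
    by (rule DERIV_continuous_on[of _ _ v']) (use v in \<open>blast intro: DERIV_subset\<close>)
  define w where "w t = V h s x0 t - v t * U h s x0 t" for t
  have w: "w t \<ge> 0" if t: "t \<in> {s..e}" and pos: "\<forall>\<tau>\<in>{s..t}. U h s x0 \<tau> \<ge> 0" for t
  proof -
    have "s \<le> t" using t by simp
    obtain C where "C > 0" "w t \<ge> C * w s"
    proof (rule linear_inequality[OF \<open>s \<le> t\<close>, of "\<lambda>t. - v t" w])
      show "continuous_on {s..t} (\<lambda>t. - v t)"
        using vc t by (auto intro!: continuous_intros elim: continuous_on_subset)
      fix \<tau> assume \<tau>: "\<tau> \<in> {s..t}"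
      then show "(w has_real_derivative
          (h \<tau> * U h s x0 \<tau> - v' \<tau> * U h s x0 \<tau> - v \<tau> * V h s x0 \<tau>)) (at \<tau>)"
        unfolding w_def using t by (auto intro!: derivative_eq_intros d v simp: algebra_simps)
      have "v' \<tau> * U h s x0 \<tau> \<le> (h \<tau> - (v \<tau>)\<^sup>2) * U h s x0 \<tau>"
        using le[of \<tau>] pos \<tau> t by (intro mult_right_mono) auto
      then show "- v \<tau> * w \<tau> \<le> h \<tau> * U h s x0 \<tau> - v' \<tau> * U h s x0 \<tau> - v \<tau> * V h s x0 \<tau>"
        by (simp add: w_def algebra_simps power2_eq_square)
    qed
    moreover have "w s \<ge> 0" using x0 i by (simp add: w_def)
    ultimately show ?thesis by (meson less_imp_le mult_nonneg_nonneg order_trans)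
  qed
  have Upos: "U h s x0 t > 0" if t: "t \<in> {s..e}" for t
  proof (rule positive_continuation[OF _ _ _ t])
    show "continuous_on {s..e} (U h s x0)"
      using d by (meson DERIV_continuous_on has_field_derivative_at_within)
    show "U h s x0 s > 0" using i by simp
    fix t assume t: "t \<in> {s..e}" and pos: "\<forall>\<tau>\<in>{s..t}. U h s x0 \<tau> \<ge> 0"
    then have "s \<le> t" by simp
    obtain C where "C > 0" "U h s x0 t \<ge> C * U h s x0 s"
    proof (rule linear_inequality[OF \<open>s \<le> t\<close>, of v "U h s x0"])
      show "continuous_on {s..t} v" using vc t by (auto elim: continuous_on_subset)
      fix \<tau> assume "\<tau> \<in> {s..t}"
      then show "v \<tau> * U h s x0 \<tau> \<le> V h s x0 \<tau>" using w[of \<tau>] t pos by (auto simp: w_def)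
    qed (rule d)
    then show "U h s x0 t > 0" using i by (simp add: less_le_trans)
  qed
  have "w t \<ge> 0" by (rule w[OF t]) (use Upos t in \<open>auto intro!: less_imp_le\<close>)
  with Upos[OF t] show ?thesis by (simp add: w_def)
qed

lemma lower_solution_left:
  assumes h: "bcont h" and v: "\<And>t. t \<in> {e..s} \<Longrightarrow> (v has_real_derivative v' t) (at t)"
    and le: "\<And>t. t \<in> {e..s} \<Longrightarrow> v' t \<le> h t - (v t)\<^sup>2" and x0: "x0 \<le> v s" and t: "t \<in> {e..s}"
  shows "U h s x0 t > 0 \<and> V h s x0 t \<le> v t * U h s x0 t"
proof -
  have "U (\<lambda>t. h (- t)) (- s) (- x0) (- t) > 0 \<and>
      - v (- (- t)) * U (\<lambda>t. h (- t)) (- s) (- x0) (- t) \<le> V (\<lambda>t. h (- t)) (- s) (- x0) (- t)"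
    by (rule lower_solution_right[OF bcont_reflect[OF h], of "- s" "- e" "\<lambda>t. - v (- t)" "\<lambda>t. v' (- t)"])
      (use le[of "- _"] x0 t in \<open>auto intro!: has_derivative_reflect v\<close>)
  then show ?thesis by (simp add: U_reflect[OF h])
qed

text \<open>Every Riccati solution is \<open>u'/u\<close> for the linear solution with matching data: the defect
\<open>w = u' - x u\<close> now solves \<open>w' = - x w\<close> with \<open>w(s) = 0\<close>.\<close>

lemma riccati_right:
  assumes h: "bcont h" and x: "riccati h x {s..e}" and t: "t \<in> {s..e}"
  shows "U h s (x s) t > 0" "x t = V h s (x s) t / U h s (x s) t"
proof -
  note d = U_deriv[OF h, of s "x s"] and i = lin_sol(2,3)[OF h, of s "x s"]
  show pos: "U h s (x s) t > 0"
    using lower_solution_right[OF h riccatiD[OF x] _ _ t, of "x s"] by auto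
  define w where "w t = V h s (x s) t - x t * U h s (x s) t" for t
  have "sgn (w s) = sgn (w t)"
  proof (rule linear_equality[of s t "\<lambda>t. - x t" w])
    show "continuous_on {s..t} (\<lambda>t. - x t)"
      using t by (auto intro!: continuous_intros continuous_on_subset[OF riccati_continuous[OF x]])
    fix \<tau> assume "\<tau> \<in> {s..t}"
    then show "(w has_real_derivative - x \<tau> * w \<tau>) (at \<tau>)" unfolding w_def
      using t by (auto intro!: derivative_eq_intros d riccatiD[OF x] simp: algebra_simps power2_eq_square)
  qed (use t in auto)
  moreover have "w s = 0" by (simp add: w_def i)
  ultimately have "w t = 0" by (simp add: sgn_zero_iff)
  with pos show "x t = V h s (x s) t / U h s (x s) t" by (simp add: w_def field_simps)
qed

lemma riccati_left:
  assumes h: "bcont h" and x: "riccati h x {e..s}" and t: "t \<in> {e..s}"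
  shows "U h s (x s) t > 0" "x t = V h s (x s) t / U h s (x s) t"
  using riccati_right[OF bcont_reflect[OF h] riccati_subset[OF riccati_reflect[OF x]], of "- s" "- e" "- t"] t
  by (auto simp: U_reflect[OF h])

lemma riccati_lin:
  assumes h: "bcont h" and "\<And>t. t \<in> I \<Longrightarrow> U h s x0 t \<noteq> 0"
  shows "riccati h (\<lambda>t. V h s x0 t / U h s x0 t) I"
  unfolding riccati_def
proof
  fix t assume "t \<in> I"
  then have nz: "U h s x0 t \<noteq> 0" by (rule assms(2))
  from DERIV_divide[OF U_deriv(2,1)[OF h, of s x0 t] nz]
  have "((\<lambda>t. V h s x0 t / U h s x0 t) has_real_derivative
      (h t * U h s x0 t * U h s x0 t - V h s x0 t * V h s x0 t) / (U h s x0 t * U h s x0 t)) (at t)" .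
  moreover have "(h t * U h s x0 t * U h s x0 t - V h s x0 t * V h s x0 t) / (U h s x0 t * U h s x0 t)
      = h t - (V h s x0 t / U h s x0 t)\<^sup>2"
    using nz by (simp add: diff_divide_distrib power2_eq_square)
  ultimately show "((\<lambda>t. V h s x0 t / U h s x0 t) has_real_derivative
      h t - (V h s x0 t / U h s x0 t)\<^sup>2) (at t)" by simp
qed

lemma riccati_order:
  assumes "a \<le> b" and x: "riccati h x {a..b}" and y: "riccati h y {a..b}"
  shows "sgn (x a - y a) = sgn (x b - y b)"
proof (rule linear_equality[OF \<open>a \<le> b\<close>, of "\<lambda>t. - (x t + y t)"])
  show "continuous_on {a..b} (\<lambda>t. - (x t + y t))"
    by (intro continuous_intros riccati_continuous[OF x] riccati_continuous[OF y])
  fix t assume "t \<in> {a..b}"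
  then show "((\<lambda>t. x t - y t) has_real_derivative - (x t + y t) * (x t - y t)) (at t)"
    by (auto intro!: derivative_eq_intros riccatiD[OF x] riccatiD[OF y] simp: algebra_simps power2_eq_square)
qed

text \<open>Above \<open>M\<close> a solution grows backward at least like that of \<open>z' = - z\<^sup>2\<close> for \<open>z = x - M\<close>, so \<open>1/z\<close>,
which is positive, would have to become negative in finite backward time.\<close>

lemma riccati_upper:
  assumes x: "riccati h x {..s}" and M: "M \<ge> 0" "\<And>t. h t \<le> M\<^sup>2"
  shows "x s \<le> M"
proof (rule ccontr)
  assume "\<not> x s \<le> M"
  have pos: "x t - M > 0" if ts: "t \<le> s" for t
  proof -
    have "- (x t - M) < 0"
    proof (rule linear_inequality_sign(2)[OF ts, of "\<lambda>t. - (x t + M)" "\<lambda>t. - (x t - M)" "\<lambda>t. (x t)\<^sup>2 - h t"])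
      show "- (x s - M) < 0" using \<open>\<not> x s \<le> M\<close> by simp
      have "continuous_on {t..s} x"
        by (rule continuous_on_subset[OF riccati_continuous[OF x]]) auto
      then show "continuous_on {t..s} (\<lambda>t. - (x t + M))" by (intro continuous_intros)
      fix \<tau> assume "\<tau> \<in> {t..s}"
      then show "((\<lambda>t. - (x t - M)) has_real_derivative (x \<tau>)\<^sup>2 - h \<tau>) (at \<tau>)"
        by (auto intro!: derivative_eq_intros riccatiD[OF x])
      show "- (x \<tau> + M) * - (x \<tau> - M) \<le> (x \<tau>)\<^sup>2 - h \<tau>"
        using M(2)[of \<tau>] by (simp add: algebra_simps power2_eq_square)
    qed
    then show ?thesis by simp
  qed
  define y where "y t = 1 / (x t - M) - t" for t
  \<comment> \<open>By this time 1 / z, which loses at least one unit per unit of backward time, is used up.\<close>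
  define t where "t = s - 1 / (x s - M)"
  have ts: "t \<le> s" using pos[of s] by (simp add: t_def)
  have "y t \<le> y s"
  proof (rule DERIV_nonneg_imp_nondecreasing[OF ts])
    fix \<tau> assume "t \<le> \<tau>" "\<tau> \<le> s"
    then have p: "x \<tau> - M > 0" "(x has_real_derivative h \<tau> - (x \<tau>)\<^sup>2) (at \<tau>)"
      using pos riccatiD[OF x] by auto
    have "(y has_real_derivative - (h \<tau> - (x \<tau>)\<^sup>2) / (x \<tau> - M)\<^sup>2 - 1) (at \<tau>)"
      unfolding y_def using p by (auto intro!: derivative_eq_intros simp: power2_eq_square)
    moreover have "(x \<tau> - M)\<^sup>2 \<le> - (h \<tau> - (x \<tau>)\<^sup>2)"
    proof -
      have "M * M \<le> M * x \<tau>" using p M by (intro mult_left_mono) auto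
      then show ?thesis using M(2)[of \<tau>] by (simp add: power2_eq_square algebra_simps)
    qed
    then have "- (h \<tau> - (x \<tau>)\<^sup>2) / (x \<tau> - M)\<^sup>2 \<ge> 1" using p by (simp add: le_divide_eq)
    ultimately show "\<exists>z. (y has_real_derivative z) (at \<tau>) \<and> 0 \<le> z" by (meson diff_ge_0_iff_ge)
  qed
  then have "1 / (x t - M) \<le> 0" by (simp add: y_def t_def)
  with pos[OF ts] show False by (simp add: divide_le_0_iff)
qed

text \<open>No sign of \<open>m\<close> is prescribed: \<open>h \<le> m\<^sup>2\<close> makes the constant \<open>m\<close> an upper solution, and for negative
\<open>m\<close> this is a lower bound for the past of a solution.\<close>

lemma riccati_lower:
  assumes "t \<le> s" and x: "riccati h x {t..s}" and h: "\<And>t. h t \<le> m\<^sup>2" and m: "m \<le> x s"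
  shows "m \<le> x t"
proof -
  have "- (x t - m) \<le> 0"
  proof (rule linear_inequality_sign(1)[OF \<open>t \<le> s\<close>, of "\<lambda>t. - (x t + m)" "\<lambda>t. - (x t - m)" "\<lambda>t. (x t)\<^sup>2 - h t"])
    show "- (x s - m) \<le> 0" using m by simp
    show "continuous_on {t..s} (\<lambda>t. - (x t + m))"
      by (intro continuous_intros riccati_continuous[OF x])
    fix \<tau> assume "\<tau> \<in> {t..s}"
    then show "((\<lambda>t. - (x t - m)) has_real_derivative (x \<tau>)\<^sup>2 - h \<tau>) (at \<tau>)"
      by (auto intro!: derivative_eq_intros riccatiD[OF x])
    show "- (x \<tau> + m) * - (x \<tau> - m) \<le> (x \<tau>)\<^sup>2 - h \<tau>"
      using h[of \<tau>] by (simp add: algebra_simps power2_eq_square)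
  qed
  then show ?thesis by simp
qed

section \<open>Solutions that exist on a whole negative half-line\<close>

text \<open>A zero of a nonnegative solution is a double zero, and nontrivial solutions of a linear second-order
equation have none. Therefore positivity survives limits, which gives every closedness property needed
below.\<close>

lemma U_nonneg_imp_pos:
  assumes h: "bcont h" and I: "open I" "\<And>t. t \<in> I \<Longrightarrow> U h s x0 t \<ge> 0" and t: "t \<in> I"
  shows "U h s x0 t > 0"
proof (rule ccontr)
  assume "\<not> U h s x0 t > 0"
  with I(2)[OF t] have U0: "U h s x0 t = 0" by simp
  obtain d where d: "d > 0" "\<And>y. \<bar>y - t\<bar> < d \<Longrightarrow> y \<in> I"
    using I(1) t unfolding open_dist dist_real_def by blast
  have "V h s x0 t = 0"
    by (rule DERIV_local_min[OF U_deriv(1)[OF h] d(1)]) (use U0 I(2) d(2) abs_minus_commute in fastforce)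
  from lin_zero[OF h lin_sol(1)[OF h] U0 this, of s] show False by (simp add: lin_sol[OF h])
qed

text \<open>By the quotient representation this says that the Riccati solution through \<open>(s, x0)\<close> exists on
\<open>(-\<infinity>, s]\<close>.\<close>

definition pos_left :: "(real \<Rightarrow> real) \<Rightarrow> real \<Rightarrow> real \<Rightarrow> bool" where
  "pos_left h s x0 \<longleftrightarrow> (\<forall>t\<le>s. U h s x0 t > 0)"

lemma pos_left_riccati:
  assumes "bcont h" "pos_left h s x0"
  shows "riccati h (\<lambda>t. V h s x0 t / U h s x0 t) {..s}" "V h s x0 s / U h s x0 s = x0"
proof -
  have "U h s x0 t \<noteq> 0" if "t \<in> {..s}" for t
    using assms(2) that unfolding pos_left_def by force
  then show "riccati h (\<lambda>t. V h s x0 t / U h s x0 t) {..s}" by (rule riccati_lin[OF assms(1)])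
  show "V h s x0 s / U h s x0 s = x0" by (simp add: lin_sol[OF assms(1)])
qed

lemma riccati_pos_left:
  assumes h: "bcont h" and x: "riccati h x {..s}"
  shows "pos_left h s (x s)"
  unfolding pos_left_def
proof (intro allI impI)
  fix t assume "t \<le> s"
  then show "U h s (x s) t > 0"
    using riccati_left(1)[OF h riccati_subset[OF x], of t s t] by auto
qed

lemma lower_solution_pos_left:
  assumes "bcont h" "\<And>t. t \<le> s \<Longrightarrow> (v has_real_derivative v' t) (at t)"
    "\<And>t. t \<le> s \<Longrightarrow> v' t \<le> h t - (v t)\<^sup>2" "x0 \<le> v s"
  shows "pos_left h s x0"
  unfolding pos_left_def
proof (intro allI impI)
  fix t assume "t \<le> s"
  then show "U h s x0 t > 0"
    using lower_solution_left[of h t s v v' x0 t] assms by auto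
qed

lemma pos_left_mono:
  assumes "bcont h" "pos_left h s x0" "t \<le> s"
  shows "\<exists>x1. pos_left h t x1"
  using riccati_pos_left[OF assms(1) riccati_subset[OF pos_left_riccati(1)[OF assms(1,2)]]] assms(3)
  by fastforce

lemma pos_left_extend:
  assumes h: "bcont h" and p: "pos_left h s x0"
  shows "\<exists>e>s. \<exists>x1. pos_left h e x1"
proof -
  have "isCont (U h s x0) s" using U_deriv(1)[OF h] by (rule DERIV_isCont)
  moreover have "U h s x0 s \<in> {0<..}" by (simp add: lin_sol[OF h])
  ultimately obtain d where d: "d > 0" "\<And>t. \<bar>t - s\<bar> < d \<Longrightarrow> U h s x0 t > 0"
    unfolding continuous_at_open by (metis greaterThan_iff open_dist dist_real_def open_greaterThan)
  have "U h s x0 t \<noteq> 0" if "t \<in> {..s + d / 2}" for t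
  proof (cases "t \<le> s")
    case True then show ?thesis using p by (force simp: pos_left_def)
  next
    case False
    then have "\<bar>t - s\<bar> < d" using d(1) that by (auto simp: field_simps)
    then show ?thesis using d(2) by force
  qed
  from riccati_pos_left[OF h riccati_lin[OF h this]] show ?thesis
    using d(1) by (intro exI[of _ "s + d / 2"]) auto
qed

lemma pos_left_le:
  assumes "bcont h" "pos_left h s x0" "M \<ge> 0" "\<And>t. h t \<le> M\<^sup>2"
  shows "x0 \<le> M"
  using riccati_upper[OF pos_left_riccati(1)[OF assms(1,2)] assms(3,4)]
    pos_left_riccati(2)[OF assms(1,2)] by simp

lemma bcont_square_bound:
  assumes "bcont h" obtains M where "M \<ge> 0" "\<And>t. \<bar>h t\<bar> \<le> M\<^sup>2"
proof -
  obtain K where "K \<ge> 0" "\<And>t. \<bar>h t\<bar> \<le> K" using bcontE[OF assms] by blast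
  then show ?thesis using that[of "sqrt K"] by simp
qed

definition amax :: "(real \<Rightarrow> real) \<Rightarrow> real \<Rightarrow> real" where
  "amax h s = (GREATEST x0. pos_left h s x0)"

text \<open>The admissible values are bounded above because solutions that are too large blow up backward. Their
supremum is a limit of admissible values, hence gives a nonnegative and therefore positive \<open>u\<close>.\<close>

lemma pos_left_has_greatest:
  assumes h: "bcont h" and "pos_left h s x0"
  obtains m where "pos_left h s m" "\<And>x. pos_left h s x \<Longrightarrow> x \<le> m"
proof -
  obtain M where M: "M \<ge> 0" "\<And>t. \<bar>h t\<bar> \<le> M\<^sup>2" using bcont_square_bound[OF h] by blast
  define S where "S = Collect (pos_left h s)"
  have S: "S \<noteq> {}" "bdd_above S"
    using assms(2) pos_left_le[OF h _ M(1)] M(2) by (auto simp: S_def bdd_above_def abs_le_iff)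
  define A where "A = (\<Inter>t\<in>{..s}. {x. 0 \<le> U h s x t})"
  have "closed {x. 0 \<le> U h s x t}" for t
  proof -
    have eq: "(\<lambda>x. U h s x t) = (\<lambda>x. U h s 0 t + x * (U h s 1 t - U h s 0 t))"
      by (rule ext) (rule U_affine[OF h])
    have "continuous_on UNIV (\<lambda>x. U h s x t)" by (subst eq) (intro continuous_intros)
    then show ?thesis by (intro closed_Collect_le continuous_on_const)
  qed
  then have "closed A" unfolding A_def by blast
  moreover have "S \<subseteq> A" by (auto simp: S_def A_def pos_left_def less_imp_le)
  ultimately have "Sup S \<in> A" using S closed_subset_contains_Sup by blast
  then have "U h s (Sup S) t > 0" if "t < s" for t
    using that by (intro U_nonneg_imp_pos[OF h, of "{..<s}"]) (auto simp: A_def)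
  then have "pos_left h s (Sup S)"
    by (auto simp: pos_left_def le_less lin_sol[OF h])
  moreover have "x \<le> Sup S" if "pos_left h s x" for x
    using that S by (auto intro: cSup_upper simp: S_def)
  ultimately show ?thesis by (rule that)
qed

lemma amax:
  assumes "bcont h" "pos_left h s x0"
  shows "pos_left h s (amax h s)" "pos_left h s x \<Longrightarrow> x \<le> amax h s"
proof -
  obtain m where m: "pos_left h s m" "\<And>x. pos_left h s x \<Longrightarrow> x \<le> m"
    using pos_left_has_greatest[OF assms] by blast
  then have "amax h s = m" unfolding amax_def by (rule Greatest_equality)
  with m show "pos_left h s (amax h s)" "pos_left h s x \<Longrightarrow> x \<le> amax h s" by auto
qed

lemma riccati_le_amax:
  assumes "bcont h" "riccati h x {..s}" shows "x s \<le> amax h s"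
  using amax(2)[OF assms(1)] riccati_pos_left[OF assms] by blast

text \<open>If the maximal value at \<open>t\<close> were larger than \<open>x t\<close>, the solution through it would stay above \<open>x\<close> up
to \<open>s\<close> and reach a value above the maximum there.\<close>

lemma riccati_amax_unique:
  assumes h: "bcont h" and x: "riccati h x {..s}" "x s = amax h s" and t: "t \<le> s"
  shows "x t = amax h t"
proof -
  have xt: "riccati h x {..t}" using riccati_subset[OF x(1)] t by auto
  note p = riccati_pos_left[OF h xt]
  define y0 where "y0 = amax h t"
  have y0: "x t \<le> y0" "pos_left h t y0" using amax[OF h p] p by (auto simp: y0_def)
  have right: "U h t y0 \<tau> > 0" if "\<tau> \<in> {t..s}" for \<tau>
    using lower_solution_right[OF h riccatiD[OF x(1)] _ y0(1) that] by auto
  define y where "y \<tau> = V h t y0 \<tau> / U h t y0 \<tau>" for \<tau>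
  have y: "riccati h y {..s}" unfolding y_def
  proof (rule riccati_lin[OF h])
    fix \<tau> assume "\<tau> \<in> {..s}"
    then show "U h t y0 \<tau> \<noteq> 0"
      using y0(2) right[of \<tau>] by (cases "\<tau> \<le> t") (auto simp: pos_left_def dest: less_imp_neq)
  qed
  have yt: "y t = y0" by (simp add: y_def lin_sol[OF h])
  have "sgn (y t - x t) = sgn (y s - x s)"
    by (rule riccati_order[OF t riccati_subset[OF y] riccati_subset[OF x(1)]]) auto
  moreover have "y s - x s \<le> 0" using riccati_le_amax[OF h y] x(2) by simp
  ultimately have "\<not> y t - x t > 0" by (smt (verit) sgn_if)
  with y0(1) yt show ?thesis by (simp add: y0_def)
qed

text \<open>The derivative at \<open>s\<close> itself is two-sided because the solution through \<open>amax h s\<close> exists slightly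
beyond \<open>s\<close>.\<close>

lemma amax_riccati:
  assumes h: "bcont h" and p: "pos_left h s x0"
  shows "riccati h (amax h) {..s}"
proof -
  obtain e x1 where e: "e > s" "pos_left h e x1" using pos_left_extend[OF assms] by blast
  obtain x where x: "riccati h x {..e}" "x e = amax h e"
    using pos_left_riccati[OF h amax(1)[OF h e(2)]] by blast
  show ?thesis unfolding riccati_def
  proof
    fix t assume "t \<in> {..s}"
    then have t: "t \<in> {..<e}" using e by simp
    have eq: "x \<tau> = amax h \<tau>" if "\<tau> \<in> {..<e}" for \<tau>
      using that by (intro riccati_amax_unique[OF h x]) simp
    have "(x has_real_derivative h t - (amax h t)\<^sup>2) (at t)"
      using riccatiD[OF x(1), of t] t eq[OF t] by simp
    from has_field_derivative_transform_within_open[OF this open_lessThan t eq]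
    show "(amax h has_real_derivative h t - (amax h t)\<^sup>2) (at t)" .
  qed
qed

text \<open>Existence on the whole half-line excludes large values, and the past of a solution cannot fall below a
sufficiently negative constant.\<close>

lemma riccati_bounded_left:
  assumes h: "bcont h" and x: "riccati h x {..s}"
  obtains B where "\<And>t. t \<le> s \<Longrightarrow> \<bar>x t\<bar> \<le> B"
proof -
  obtain M where M: "M \<ge> 0" "\<And>t. \<bar>h t\<bar> \<le> M\<^sup>2" using bcont_square_bound[OF h] by blast
  define m where "m = - max M \<bar>x s\<bar>"
  have m: "h t \<le> m\<^sup>2" for t
  proof -
    have "M\<^sup>2 \<le> m\<^sup>2" using M(1) unfolding m_def by (simp add: power_mono)
    then show ?thesis using M(2)[of t] by linarith
  qed
  have "\<bar>x t\<bar> \<le> max M \<bar>x s\<bar>" if "t \<le> s" for t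
  proof -
    have "x t \<le> M"
      using M(2) that by (intro riccati_upper[OF riccati_subset[OF x] M(1)]) (auto simp: abs_le_iff)
    moreover have "m \<le> x t"
      by (rule riccati_lower[OF that riccati_subset[OF x] m]) (auto simp: m_def)
    ultimately show ?thesis by (auto simp: m_def)
  qed
  then show ?thesis by (rule that)
qed

section \<open>Uniform separation and stability under perturbation\<close>

text \<open>The key identity: convex combinations of two solutions are strict lower solutions, and extrapolations
(\<open>\<theta> < 0\<close>) are strict upper solutions, with a margin proportional to the squared distance.\<close>

lemma mix_derivative:
  assumes "riccati h x1 I" "riccati h x2 I" "t \<in> I"
  shows "((\<lambda>t. (1 - \<theta>) * x1 t + \<theta> * x2 t) has_real_derivative
    h t - ((1 - \<theta>) * x1 t + \<theta> * x2 t)\<^sup>2 - \<theta> * (1 - \<theta>) * (x1 t - x2 t)\<^sup>2) (at t)"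
  by (auto intro!: derivative_eq_intros riccatiD[OF assms(1,3)] riccatiD[OF assms(2,3)]
      simp: algebra_simps power2_eq_square)

text \<open>Write \<open>d = x\<^sub>1 - x\<^sub>2\<close>. The lower solution \<open>x\<^sub>1 - \<theta> d\<close> survives the perturbation, so solutions on
the half-line exist and \<open>amax g \<ge> x\<^sub>1 - \<theta> d\<close>. A solution above \<open>x\<^sub>1 + \<theta> d\<close> stays above it in the
past; for \<open>\<omega> = (y - x\<^sub>1)/d\<close> one has \<open>\<omega>' = - d \<omega> (\<omega> + 1) + (g - h)/d\<close>, so \<open>\<omega> > \<theta>\<close> forces \<open>\<omega>\<close> to
grow backward at a fixed rate, although \<open>y\<close> and \<open>x\<^sub>1\<close> are bounded.\<close>

lemma amax_perturbation:
  assumes h: "bcont h" and g: "bcont g"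
    and x1: "riccati h x1 {..T}" and x2: "riccati h x2 {..T}"
    and gap: "\<And>t. t \<le> T \<Longrightarrow> \<epsilon> \<le> x1 t - x2 t" and \<epsilon>: "\<epsilon> > 0" and \<theta>: "0 < \<theta>" "\<theta> < 1"
    and close: "\<And>t. t \<le> T \<Longrightarrow> \<bar>g t - h t\<bar> \<le> \<theta> * (1 - \<theta>) * \<epsilon>\<^sup>2" and s: "s \<le> T"
  shows "\<exists>x0. pos_left g s x0" "\<bar>amax g s - x1 s\<bar> \<le> \<theta> * (x1 s - x2 s)"
proof -
  have gap2: "\<epsilon>\<^sup>2 \<le> (x1 t - x2 t)\<^sup>2" if "t \<le> T" for t
    using gap[OF that] \<epsilon> by (simp add: power_mono)
  define v where "v \<sigma> t = (1 - \<sigma>) * x1 t + \<sigma> * x2 t" for \<sigma> t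
  have dv: "(v \<sigma> has_real_derivative h t - (v \<sigma> t)\<^sup>2 - \<sigma> * (1 - \<sigma>) * (x1 t - x2 t)\<^sup>2) (at t)"
    if "t \<le> T" for \<sigma> t
    using mix_derivative[OF x1 x2, of t \<sigma>] that unfolding v_def by simp
  have v_alt: "v \<sigma> t = x1 t - \<sigma> * (x1 t - x2 t)" for \<sigma> t by (simp add: v_def algebra_simps)
  have low: "pos_left g s (v \<theta> s)"
  proof (rule lower_solution_pos_left[OF g dv])
    fix t assume "t \<le> s"
    then have t: "t \<le> T" using s by simp
    have "\<theta> * (1 - \<theta>) * \<epsilon>\<^sup>2 \<le> \<theta> * (1 - \<theta>) * (x1 t - x2 t)\<^sup>2"
      using gap2[OF t] \<theta> by (intro mult_left_mono) auto
    then show "h t - (v \<theta> t)\<^sup>2 - \<theta> * (1 - \<theta>) * (x1 t - x2 t)\<^sup>2 \<le> g t - (v \<theta> t)\<^sup>2"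
      using close[OF t] by (simp add: abs_le_iff)
    show "t \<le> T" by (rule t)
  qed simp
  then show "\<exists>x0. pos_left g s x0" ..
  have upper: "amax g s \<le> v (- \<theta>) s"
  proof (rule ccontr)
    assume neg: "\<not> amax g s \<le> v (- \<theta>) s"
    define y where "y = amax g"
    have y: "riccati g y {..s}" unfolding y_def by (rule amax_riccati[OF g low])
    have yc: "continuous_on {a..s} y" for a
      by (rule continuous_on_subset[OF riccati_continuous[OF y]]) auto
    have vc: "continuous_on {a..s} (v (- \<theta>))" for a
      using s by (intro DERIV_continuous_on[OF has_field_derivative_at_within[OF dv]]) auto
    have above: "v (- \<theta>) t - y t < 0" if t: "t \<le> s" for t
    proof (rule linear_inequality_sign(2)[OF t, of "\<lambda>t. - (y t + v (- \<theta>) t)" "\<lambda>t. v (- \<theta>) t - y t"])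
      show "continuous_on {t..s} (\<lambda>t. - (y t + v (- \<theta>) t))" by (intro continuous_intros yc vc)
      show "v (- \<theta>) s - y s < 0" using neg by (simp add: y_def)
      fix \<tau> assume \<tau>: "\<tau> \<in> {t..s}"
      then have T: "\<tau> \<le> T" using s by simp
      have "(y has_real_derivative g \<tau> - (y \<tau>)\<^sup>2) (at \<tau>)" using \<tau> by (intro riccatiD[OF y]) auto
      from DERIV_diff[OF dv[OF T] this]
      show "((\<lambda>t. v (- \<theta>) t - y t) has_real_derivative
        h \<tau> - (v (- \<theta>) \<tau>)\<^sup>2 - - \<theta> * (1 - - \<theta>) * (x1 \<tau> - x2 \<tau>)\<^sup>2 - (g \<tau> - (y \<tau>)\<^sup>2)) (at \<tau>)" .
      have "\<theta> * (1 - \<theta>) * \<epsilon>\<^sup>2 \<le> \<theta> * (1 + \<theta>) * (x1 \<tau> - x2 \<tau>)\<^sup>2"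
        using gap2[OF T] \<theta> by (intro mult_mono) auto
      then show "- (y \<tau> + v (- \<theta>) \<tau>) * (v (- \<theta>) \<tau> - y \<tau>) \<le>
        h \<tau> - (v (- \<theta>) \<tau>)\<^sup>2 - - \<theta> * (1 - - \<theta>) * (x1 \<tau> - x2 \<tau>)\<^sup>2 - (g \<tau> - (y \<tau>)\<^sup>2)"
        using close[OF T] by (simp add: abs_le_iff algebra_simps power2_eq_square)
    qed
    define d where "d t = x1 t - x2 t" for t
    define \<omega> where "\<omega> t = (y t - x1 t) / d t" for t
    have dpos: "d t > 0" "\<epsilon> \<le> d t" if "t \<le> T" for t using gap[OF that] \<epsilon> by (auto simp: d_def)
    have \<omega>: "\<theta> < \<omega> t" if "t \<le> s" for t
      using above[OF that] dpos[of t] that s by (simp add: \<omega>_def v_alt d_def[symmetric] less_divide_eq)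
    obtain B1 where B1: "\<And>t. t \<le> s \<Longrightarrow> \<bar>y t\<bar> \<le> B1" using riccati_bounded_left[OF g y] by blast
    obtain B2 where B2: "\<And>t. t \<le> T \<Longrightarrow> \<bar>x1 t\<bar> \<le> B2" using riccati_bounded_left[OF h x1] by blast
    define \<mu> where "\<mu> = 2 * \<theta>\<^sup>2 * \<epsilon>"
    have \<mu>: "\<mu> > 0" using \<theta> \<epsilon> by (simp add: \<mu>_def)
    \<comment> \<open>At this time the guaranteed growth of \<omega> reaches its a priori bound (B1 + B2) / \<epsilon>.\<close>
    define t where "t = s - (B1 + B2) / \<epsilon> / \<mu>"
    have "B1 \<ge> 0" "B2 \<ge> 0" using B1[of s] B2[of T] by auto
    then have ts: "t \<le> s" using \<mu> \<epsilon> by (simp add: t_def)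
    have "\<omega> t + \<mu> * t \<ge> \<omega> s + \<mu> * s"
    proof (rule DERIV_nonpos_imp_nonincreasing[OF ts, of "\<lambda>t. \<omega> t + \<mu> * t"])
      fix \<tau> assume \<tau>: "t \<le> \<tau>" "\<tau> \<le> s"
      then have T: "\<tau> \<le> T" using s by simp
      note D = riccatiD[OF x1, of \<tau>] riccatiD[OF x2, of \<tau>] riccatiD[OF y, of \<tau>]
      have "((\<lambda>t. \<omega> t + \<mu> * t) has_real_derivative
          (g \<tau> - h \<tau>) / d \<tau> - d \<tau> * (\<omega> \<tau> * (\<omega> \<tau> + 1)) + \<mu>) (at \<tau>)"
      proof -
        have dd: "(d has_real_derivative - (x1 \<tau> + x2 \<tau>) * d \<tau>) (at \<tau>)"
          unfolding d_def using D T by (auto intro!: derivative_eq_intros simp: algebra_simps power2_eq_square)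
        have "((\<lambda>t. y t - x1 t) has_real_derivative g \<tau> - h \<tau> - (y \<tau> + x1 \<tau>) * (y \<tau> - x1 \<tau>)) (at \<tau>)"
          using D T \<tau> by (auto intro!: derivative_eq_intros simp: algebra_simps power2_eq_square)
        from DERIV_divide[OF this dd] dpos(1)[OF T]
        have "(\<omega> has_real_derivative ((g \<tau> - h \<tau> - (y \<tau> + x1 \<tau>) * (y \<tau> - x1 \<tau>)) * d \<tau> -
            (y \<tau> - x1 \<tau>) * (- (x1 \<tau> + x2 \<tau>) * d \<tau>)) / (d \<tau> * d \<tau>)) (at \<tau>)"
          unfolding \<omega>_def by simp
        moreover have "((g \<tau> - h \<tau> - (y \<tau> + x1 \<tau>) * (y \<tau> - x1 \<tau>)) * d \<tau> -
            (y \<tau> - x1 \<tau>) * (- (x1 \<tau> + x2 \<tau>) * d \<tau>)) / (d \<tau> * d \<tau>)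
            = (g \<tau> - h \<tau>) / d \<tau> - d \<tau> * (\<omega> \<tau> * (\<omega> \<tau> + 1))"
        proof -
          have e: "y \<tau> - x1 \<tau> = \<omega> \<tau> * d \<tau>" "y \<tau> - x2 \<tau> = (\<omega> \<tau> + 1) * d \<tau>"
          proof -
            show e1: "y \<tau> - x1 \<tau> = \<omega> \<tau> * d \<tau>" using dpos(1)[OF T] by (simp add: \<omega>_def)
            have "y \<tau> - x2 \<tau> = (y \<tau> - x1 \<tau>) + d \<tau>" by (simp add: d_def)
            then show "y \<tau> - x2 \<tau> = (\<omega> \<tau> + 1) * d \<tau>" unfolding e1 by (simp add: algebra_simps)
          qed
          have "(g \<tau> - h \<tau> - (y \<tau> + x1 \<tau>) * (y \<tau> - x1 \<tau>)) * d \<tau> -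
            (y \<tau> - x1 \<tau>) * (- (x1 \<tau> + x2 \<tau>) * d \<tau>)
            = (g \<tau> - h \<tau>) * d \<tau> - (y \<tau> - x1 \<tau>) * (y \<tau> - x2 \<tau>) * d \<tau>" by (simp add: algebra_simps)
          also have "\<dots> = (g \<tau> - h \<tau>) * d \<tau> - d \<tau> * (\<omega> \<tau> * (\<omega> \<tau> + 1)) * (d \<tau> * d \<tau>)"
            unfolding e by (simp add: algebra_simps)
          finally show ?thesis using dpos(1)[OF T] by (simp add: diff_divide_distrib)
        qed
        ultimately have "(\<omega> has_real_derivative (g \<tau> - h \<tau>) / d \<tau> - d \<tau> * (\<omega> \<tau> * (\<omega> \<tau> + 1))) (at \<tau>)" by simp
        then show ?thesis by (auto intro!: derivative_eq_intros)
      qed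
      moreover have "(g \<tau> - h \<tau>) / d \<tau> - d \<tau> * (\<omega> \<tau> * (\<omega> \<tau> + 1)) + \<mu> \<le> 0"
      proof -
        have "(g \<tau> - h \<tau>) / d \<tau> \<le> (\<theta> * (1 - \<theta>) * \<epsilon>\<^sup>2) / d \<tau>"
          using close[OF T] dpos[OF T] by (intro divide_right_mono) (auto simp: abs_le_iff)
        also have "\<dots> \<le> (\<theta> * (1 - \<theta>) * \<epsilon>\<^sup>2) / \<epsilon>"
          using \<theta> \<epsilon> dpos[OF T] by (intro divide_left_mono) auto
        also have "\<dots> = \<theta> * (1 - \<theta>) * \<epsilon>" using \<epsilon> by (simp add: power2_eq_square)
        finally have 1: "(g \<tau> - h \<tau>) / d \<tau> \<le> \<theta> * (1 - \<theta>) * \<epsilon>" .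
        have "\<epsilon> * (\<theta> * (\<theta> + 1)) \<le> d \<tau> * (\<omega> \<tau> * (\<omega> \<tau> + 1))"
          using \<theta> \<epsilon> dpos[OF T] \<omega>[OF \<tau>(2)] by (intro mult_mono) auto
        with 1 show ?thesis by (simp add: \<mu>_def algebra_simps power2_eq_square)
      qed
      ultimately show "\<exists>z. ((\<lambda>t. \<omega> t + \<mu> * t) has_real_derivative z) (at \<tau>) \<and> z \<le> 0" by blast
    qed
    then have "\<omega> s + \<mu> * (s - t) \<le> \<omega> t" by (simp add: algebra_simps)
    moreover have "\<mu> * (s - t) = (B1 + B2) / \<epsilon>" using \<mu> by (simp add: t_def)
    moreover have "\<omega> t \<le> (B1 + B2) / \<epsilon>"
    proof -
      have T: "t \<le> T" using ts s by simp
      have "\<omega> t \<le> (B1 + B2) / d t" unfolding \<omega>_def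
        using B1[OF ts] B2[OF T] dpos[OF T] by (intro divide_right_mono) auto
      also have "\<dots> \<le> (B1 + B2) / \<epsilon>"
        using \<epsilon> dpos[OF T] \<open>B1 \<ge> 0\<close> \<open>B2 \<ge> 0\<close> by (intro divide_left_mono) auto
      finally show ?thesis .
    qed
    ultimately show False using \<omega>[of s] \<theta> by simp
  qed
  moreover have "v \<theta> s \<le> amax g s" by (rule amax(2)[OF g low low])
  ultimately show "\<bar>amax g s - x1 s\<bar> \<le> \<theta> * (x1 s - x2 s)" by (simp add: v_alt abs_le_iff)
qed

text \<open>Write \<open>x = amax g\<close>. Near \<open>-\<infinity>\<close> the solution \<open>x\<close> is within \<open>d/8\<close> of \<open>x\<^sub>1\<close>, where \<open>d = x\<^sub>1 - x\<^sub>2\<close>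
(this is the perturbation lemma with \<open>\<theta> = 1/8\<close>, and \<open>\<theta> (1 - \<theta>) = 7/64\<close>). Then \<open>e = d/(x - y)\<close>
satisfies \<open>e' = c e - d\<close> with \<open>c \<ge> 3 d/4\<close>, so backward it cannot exceed the larger of \<open>2\<close> and its
value at \<open>T'\<close>; a bound on \<open>e\<close> is a lower bound on \<open>x - y\<close>. The remaining interval is compact.\<close>

lemma amax_separated:
  assumes h: "bcont h" and g: "bcont g"
    and x1: "riccati h x1 {..T}" and x2: "riccati h x2 {..T}"
    and gap: "\<And>t. t \<le> T \<Longrightarrow> \<epsilon> \<le> x1 t - x2 t" and \<epsilon>: "\<epsilon> > 0"
    and close: "\<And>t. t \<le> T \<Longrightarrow> \<bar>g t - h t\<bar> \<le> 7 / 64 * \<epsilon>\<^sup>2"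
    and y: "riccati g y {..k}" "y k < amax g k"
  obtains \<epsilon>' where "\<epsilon>' > 0" "\<And>t. t \<le> k \<Longrightarrow> \<epsilon>' \<le> amax g t - y t"
proof -
  define x where "x = amax g"
  have x: "riccati g x {..k}" unfolding x_def
    by (rule amax_riccati[OF g riccati_pos_left[OF g y(1)]])
  have pos: "x t - y t > 0" if "t \<le> k" for t
  proof -
    have "sgn (x t - y t) = sgn (x k - y k)"
      by (rule riccati_order[OF that riccati_subset[OF x] riccati_subset[OF y(1)]]) auto
    then show ?thesis using y(2) by (simp add: x_def sgn_if split: if_splits)
  qed
  define T' where "T' = min T k"
  define d where "d t = x1 t - x2 t" for t
  have dpos: "d t > 0" "\<epsilon> \<le> d t" if "t \<le> T'" for t using gap[of t] \<epsilon> that by (auto simp: d_def T'_def)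
  have near: "\<bar>x t - x1 t\<bar> \<le> 1 / 8 * d t" if "t \<le> T'" for t
    unfolding x_def d_def
    by (rule amax_perturbation(2)[OF h g x1 x2 gap \<epsilon>]) (use close that in \<open>auto simp: T'_def\<close>)
  define e where "e t = d t / (x t - y t)" for t
  \<comment> \<open>Any constant of at least 4/3 is a barrier, because then c * E0 \<ge> d.\<close>
  define E0 where "E0 = max 2 (e T')"
  define c where "c t = 2 * (x t - x1 t) + d t" for t
  have c: "c t \<ge> 3 / 4 * d t" if "t \<le> T'" for t     using near[OF that] abs_ge_minus_self[of "x t - x1 t"] unfolding c_def by argo
  have e_le: "e t \<le> E0" if t: "t \<le> T'" for t
  proof -
    have "e t - E0 \<le> 0"
    proof (rule linear_inequality_sign(1)[OF t, of c "\<lambda>t. e t - E0"])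
      show "continuous_on {t..T'} c" unfolding c_def d_def
        by (intro continuous_intros continuous_on_subset[OF riccati_continuous[OF x]]
            continuous_on_subset[OF riccati_continuous[OF x1]] continuous_on_subset[OF riccati_continuous[OF x2]])
          (auto simp: T'_def)
      show "e T' - E0 \<le> 0" by (simp add: E0_def)
      fix \<tau> assume "\<tau> \<in> {t..T'}"
      then have \<tau>: "\<tau> \<le> T'" "\<tau> \<le> T" "\<tau> \<le> k" by (auto simp: T'_def)
      note D = riccatiD[OF x1, of \<tau>] riccatiD[OF x2, of \<tau>] riccatiD[OF x, of \<tau>] riccatiD[OF y(1), of \<tau>]
      have dd: "(d has_real_derivative - (x1 \<tau> + x2 \<tau>) * d \<tau>) (at \<tau>)"
        unfolding d_def using D \<tau> by (auto intro!: derivative_eq_intros simp: algebra_simps power2_eq_square)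
      have "((\<lambda>t. x t - y t) has_real_derivative - (x \<tau> + y \<tau>) * (x \<tau> - y \<tau>)) (at \<tau>)"
        using D \<tau> by (auto intro!: derivative_eq_intros simp: algebra_simps power2_eq_square)
      from DERIV_divide[OF dd this] pos[OF \<tau>(3)]
      have "(e has_real_derivative (- (x1 \<tau> + x2 \<tau>) * d \<tau> * (x \<tau> - y \<tau>) -
          d \<tau> * (- (x \<tau> + y \<tau>) * (x \<tau> - y \<tau>))) / ((x \<tau> - y \<tau>) * (x \<tau> - y \<tau>))) (at \<tau>)"
        unfolding e_def by simp
      moreover have "(- (x1 \<tau> + x2 \<tau>) * d \<tau> * (x \<tau> - y \<tau>) -
          d \<tau> * (- (x \<tau> + y \<tau>) * (x \<tau> - y \<tau>))) / ((x \<tau> - y \<tau>) * (x \<tau> - y \<tau>)) = c \<tau> * e \<tau> - d \<tau>"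
      proof -
        have ed: "d \<tau> = e \<tau> * (x \<tau> - y \<tau>)" using pos[OF \<tau>(3)] by (simp add: e_def)
        have "- (x1 \<tau> + x2 \<tau>) * d \<tau> * (x \<tau> - y \<tau>) - d \<tau> * (- (x \<tau> + y \<tau>) * (x \<tau> - y \<tau>))
          = (c \<tau> - (x \<tau> - y \<tau>)) * d \<tau> * (x \<tau> - y \<tau>)"
          by (simp add: c_def d_def algebra_simps)
        also have "\<dots> = (c \<tau> * e \<tau> - d \<tau>) * ((x \<tau> - y \<tau>) * (x \<tau> - y \<tau>))"
          unfolding ed by (simp add: algebra_simps)
        finally show ?thesis using pos[OF \<tau>(3)] by simp
      qed
      ultimately show "((\<lambda>t. e t - E0) has_real_derivative c \<tau> * e \<tau> - d \<tau>) (at \<tau>)"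
        by (auto intro!: derivative_eq_intros)
      have "d \<tau> \<le> c \<tau> * E0"
      proof -
        have "d \<tau> \<le> (3 / 4 * d \<tau>) * 2" using dpos[OF \<tau>(1)] by simp
        also have "\<dots> \<le> c \<tau> * E0" using c[OF \<tau>(1)] dpos[OF \<tau>(1)] by (intro mult_mono) (auto simp: E0_def)
        finally show ?thesis .
      qed
      then show "c \<tau> * (e \<tau> - E0) \<le> c \<tau> * e \<tau> - d \<tau>" by (simp add: algebra_simps)
    qed
    then show ?thesis by simp
  qed
  have far: "\<epsilon> / E0 \<le> x t - y t" if "t \<le> T'" for t
  proof -
    have "t \<le> k" using that by (simp add: T'_def)
    have E0: "E0 > 0" by (simp add: E0_def)
    have "d t \<le> E0 * (x t - y t)"
      using e_le[OF that] pos[OF \<open>t \<le> k\<close>] by (simp add: e_def pos_divide_le_eq)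
    then show ?thesis using dpos[OF that] E0 by (simp add: pos_divide_le_eq mult.commute)
  qed
  have "T' \<le> k" by (simp add: T'_def)
  have "continuous_on {T'..k} (\<lambda>t. x t - y t)"
    by (intro continuous_intros continuous_on_subset[OF riccati_continuous[OF x]]
        continuous_on_subset[OF riccati_continuous[OF y(1)]]) auto
  from continuous_attains_inf[OF compact_Icc _ this] \<open>T' \<le> k\<close>
  obtain z where z: "z \<in> {T'..k}" "\<And>t. t \<in> {T'..k} \<Longrightarrow> x z - y z \<le> x t - y t" by auto
  show ?thesis
  proof (rule that[of "min (\<epsilon> / E0) (x z - y z)"])
    show "min (\<epsilon> / E0) (x z - y z) > 0" using \<epsilon> pos[of z] z(1) by (auto simp: E0_def)
    fix t assume "t \<le> k"
    then show "min (\<epsilon> / E0) (x z - y z) \<le> amax g t - y t"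
      using far[of t] z(2)[of t] by (cases "t \<le> T'") (auto simp: x_def)
  qed
qed

section \<open>Global solutions and the threshold value\<close>

lemma riccati_global_bound:
  assumes x: "riccati h x UNIV" and M: "M \<ge> 0" "\<And>t. h t \<le> M\<^sup>2"
  shows "\<bar>x t\<bar> \<le> M"
proof -
  have "x t \<le> M" by (rule riccati_upper[OF riccati_subset[OF x] M]) auto
  moreover have "- x (- (- t)) \<le> M"
    by (rule riccati_upper[OF riccati_subset[OF riccati_reflect[OF x]] M(1), of "- t"]) (auto simp: M(2))
  ultimately show ?thesis by (simp add: abs_le_iff)
qed

lemma bounded_solution_iff_riccati:
  assumes "bcont h"
  shows "bounded_solution (\<lambda>t x. - x\<^sup>2 + h t) x \<longleftrightarrow> riccati h x UNIV"
proof -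
  obtain M where M: "M \<ge> 0" "\<And>t. \<bar>h t\<bar> \<le> M\<^sup>2" using bcont_square_bound[OF assms] by blast
  have "bounded (range x)" if "riccati h x UNIV"
    using riccati_global_bound[OF that M(1)] M(2) unfolding bounded_iff by (auto simp: abs_le_iff)
  then show ?thesis by (auto simp: bounded_solution_def global_solution_def riccati_def)
qed

lemma global_lower_solution:
  assumes h: "bcont h" and v: "\<And>t. (v has_real_derivative v' t) (at t)"
    and le: "\<And>t. v' t \<le> h t - (v t)\<^sup>2"
  shows "\<exists>x. riccati h x UNIV"
proof -
  have "U h 0 (v 0) t \<noteq> 0" for t
    using lower_solution_left[OF h v le, of "v 0" 0 t t] lower_solution_right[OF h v le, of 0 "v 0" t t]
    by (cases "t \<le> 0") auto
  then show ?thesis using riccati_lin[OF h] by blast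
qed

text \<open>Continuous dependence on an additive constant, from the energy estimate for the difference of the two
solutions.\<close>

lemma U_param_limit:
  assumes h: "bcont h" and m: "m \<longlonglongrightarrow> m0"
  shows "(\<lambda>n. U (\<lambda>t. h t + m n) s x0 t) \<longlonglongrightarrow> U (\<lambda>t. h t + m0) s x0 t"
proof -
  have right: "(\<lambda>n. U (\<lambda>t. h t + m n) s x0 t) \<longlonglongrightarrow> U (\<lambda>t. h t + m0) s x0 t"
    if h: "bcont h" and st: "s \<le> t" for h s x0 t
  proof -
    obtain K where K: "\<And>t. \<bar>h t\<bar> \<le> K" using bcontE[OF h] by blast
    have "Bseq m" using m by (rule convergent_imp_Bseq[OF convergentI])
    then obtain Bm where Bm: "\<And>n. \<bar>m n\<bar> \<le> Bm" unfolding Bseq_def by auto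
    have H: "bcont (\<lambda>t. h t + c)" for c by (rule bcont_add_const[OF h])
    have "continuous_on {s..t} (U (\<lambda>t. h t + m0) s x0)"
      by (rule DERIV_continuous_on[OF has_field_derivative_at_within[OF U_deriv(1)[OF H]]])
    from compact_imp_bounded[OF compact_continuous_image[OF this compact_Icc]]
    obtain B where B: "\<And>\<tau>. \<tau> \<in> {s..t} \<Longrightarrow> \<bar>U (\<lambda>t. h t + m0) s x0 \<tau>\<bar> \<le> B"
      unfolding bounded_iff by (metis imageI real_norm_def)
    define C where "C = sqrt (B\<^sup>2 * (t - s) * exp ((2 + (K + Bm)) * (t - s)))"
    have C: "C\<^sup>2 = B\<^sup>2 * (t - s) * exp ((2 + (K + Bm)) * (t - s))" "C \<ge> 0"
      using st by (simp_all add: C_def)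
    have est: "\<bar>U (\<lambda>t. h t + m n) s x0 t - U (\<lambda>t. h t + m0) s x0 t\<bar> \<le> \<bar>m n - m0\<bar> * C" for n
    proof (rule power2_le_imp_le)
      define u where "u \<tau> = U (\<lambda>t. h t + m n) s x0 \<tau> - U (\<lambda>t. h t + m0) s x0 \<tau>" for \<tau>
      define v where "v \<tau> = V (\<lambda>t. h t + m n) s x0 \<tau> - V (\<lambda>t. h t + m0) s x0 \<tau>" for \<tau>
      have "(u t)\<^sup>2 + (v t)\<^sup>2 \<le> (\<bar>m n - m0\<bar> * B)\<^sup>2 * (t - s) * exp ((2 + (K + Bm)) * (t - s))"
      proof (rule energy_estimate[of u v "\<lambda>t. h t + m n" "\<lambda>\<tau>. (m n - m0) * U (\<lambda>t. h t + m0) s x0 \<tau>"])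
        show "(u has_real_derivative v \<tau>) (at \<tau>)" for \<tau>
          unfolding u_def v_def by (intro DERIV_diff U_deriv H)
        show "(v has_real_derivative (h \<tau> + m n) * u \<tau> + (m n - m0) * U (\<lambda>t. h t + m0) s x0 \<tau>) (at \<tau>)" for \<tau>
          unfolding u_def v_def
          by (rule DERIV_cong[OF DERIV_diff[OF U_deriv(2)[OF H] U_deriv(2)[OF H]]]) (simp add: algebra_simps)
        show "u s = 0" "v s = 0" by (simp_all add: u_def v_def lin_sol[OF H])
        show "\<bar>h t + m n\<bar> \<le> K + Bm" for t
          using K[of t] Bm[of n] by (meson abs_triangle_ineq add_mono order_trans)
        show "\<bar>(m n - m0) * U (\<lambda>t. h t + m0) s x0 \<tau>\<bar> \<le> \<bar>m n - m0\<bar> * B" if "s \<le> \<tau>" "\<tau> \<le> t" for \<tau>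
          using B[of \<tau>] that by (auto simp: abs_mult intro!: mult_left_mono)
      qed (rule st)
      also have "\<dots> = (\<bar>m n - m0\<bar> * C)\<^sup>2" by (simp add: power_mult_distrib C)
      finally have "(u t)\<^sup>2 \<le> (\<bar>m n - m0\<bar> * C)\<^sup>2" using zero_le_power2[of "v t"] by linarith
      then show "\<bar>U (\<lambda>t. h t + m n) s x0 t - U (\<lambda>t. h t + m0) s x0 t\<bar>\<^sup>2 \<le> (\<bar>m n - m0\<bar> * C)\<^sup>2"
        by (simp add: u_def)
    qed (use C in auto)
    have "(\<lambda>n. m n - m0) \<longlonglongrightarrow> 0" using m by (rule LIM_zero)
    then have "(\<lambda>n. \<bar>m n - m0\<bar> * C) \<longlonglongrightarrow> 0"
      by (intro tendsto_mult_left_zero tendsto_rabs_zero)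
    then have "(\<lambda>n. U (\<lambda>t. h t + m n) s x0 t - U (\<lambda>t. h t + m0) s x0 t) \<longlonglongrightarrow> 0"
      by (rule Lim_null_comparison[rotated]) (use est in auto)
    then show ?thesis by (rule LIM_zero_cancel)
  qed
  show ?thesis
  proof (cases "s \<le> t")
    case True then show ?thesis using right[OF h] by blast
  next
    case False
    then have "(\<lambda>n. U (\<lambda>t. h (- t) + m n) (- s) (- x0) (- t)) \<longlonglongrightarrow> U (\<lambda>t. h (- t) + m0) (- s) (- x0) (- t)"
      by (intro right[OF bcont_reflect[OF h]]) simp
    then show ?thesis
      using U_reflect(1)[OF bcont_add_const[OF h]] by simp
  qed
qed

text \<open>The admissible constants \<open>m\<close> are closed upward, since a solution for \<open>m\<close> is a lower solution for every
larger constant, and they are bounded below, since \<open>h + m < 0\<close> leaves no bounded solution. The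
infimum \<open>l\<close> is attained: solutions for \<open>l + 1/(n+1)\<close> are uniformly bounded, a subsequence of their
values at \<open>0\<close> converges, and the limiting \<open>u\<close> is nonnegative, hence positive.\<close>

lemma threshold_exists:
  assumes h: "bcont h"
  shows "\<exists>!l. \<forall>m. (\<exists>x. riccati (\<lambda>t. h t + m) x UNIV) \<longleftrightarrow> l \<le> m"
proof -
  define S where "S = {m. \<exists>x. riccati (\<lambda>t. h t + m) x UNIV}"
  have H: "bcont (\<lambda>t. h t + c)" for c by (rule bcont_add_const[OF h])
  obtain K where K: "K \<ge> 0" "\<And>t. \<bar>h t\<bar> \<le> K" using bcontE[OF h] by blast
  have up: "m' \<in> S" if m: "m \<in> S" "m \<le> m'" for m m'
  proof -
    obtain x where "riccati (\<lambda>t. h t + m) x UNIV" using m by (auto simp: S_def)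
    then have "\<exists>x. riccati (\<lambda>t. h t + m') x UNIV"
      using m(2) by (intro global_lower_solution[OF H riccatiD]) auto
    then show ?thesis by (simp add: S_def)
  qed
  have "\<exists>x. riccati (\<lambda>t. h t + K) x UNIV"
  proof (rule global_lower_solution[OF H, of "\<lambda>_. 0" "\<lambda>_. 0"])
    show "0 \<le> h t + K - 0\<^sup>2" for t using abs_le_D2[OF K(2)[of t]] by simp
  qed simp
  then have K_in: "K \<in> S" by (simp add: S_def)
  have low: "- K \<le> m" if mS: "m \<in> S" for m
  proof (rule ccontr)
    assume "\<not> - K \<le> m"
    then have neg: "h t + m < 0" for t using K(2)[of t] by (simp add: abs_le_iff)
    obtain x where x: "riccati (\<lambda>t. h t + m) x UNIV" using mS by (auto simp: S_def)
    have "x t = 0" for t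
      using riccati_global_bound[OF x, of 0 t] neg by (simp add: less_imp_le)
    then have "x = (\<lambda>_. 0)" by blast
    with riccatiD[OF x, of 0] have "((\<lambda>_. 0) has_real_derivative h 0 + m) (at 0)" by simp
    with DERIV_const have "h 0 + m = 0" by (metis DERIV_unique)
    with neg[of 0] show False by simp
  qed
  have S: "S \<noteq> {}" "bdd_below S" using K_in low by (auto simp: bdd_below_def)
  define l where "l = Inf S"
  have "l \<in> S"
  proof -
    define m where "m n = l + inverse (real (Suc n))" for n
    have ml: "m \<longlonglongrightarrow> l" unfolding m_def using LIMSEQ_inverse_real_of_nat_add by simp
    have "m n \<in> S" for n
    proof -
      have "Inf S < m n" by (simp add: m_def l_def)
      then obtain m' where "m' \<in> S" "m' < m n" using S by (meson cInf_lessD)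
      then show ?thesis using up by fastforce
    qed
    then have "\<forall>n. \<exists>y. riccati (\<lambda>t. h t + m n) y UNIV" by (simp add: S_def)
    from choice[OF this] obtain x where x: "\<And>n. riccati (\<lambda>t. h t + m n) (x n) UNIV" by blast
    obtain M where M: "M \<ge> 0" "\<And>t. \<bar>h t + (l + 1)\<bar> \<le> M\<^sup>2" using bcont_square_bound[OF H] by blast
    have "\<bar>x n 0\<bar> \<le> M" for n
    proof (rule riccati_global_bound[OF x M(1)])
      fix t
      have "m n \<le> l + 1" by (simp add: m_def field_simps)
      then show "h t + m n \<le> M\<^sup>2" using M(2)[of t] by (simp add: abs_le_iff)
    qed
    then have "\<forall>n. x n 0 \<in> {-M..M}" by (simp add: abs_le_iff minus_le_iff)
    then obtain x0 r where r: "strict_mono r" "((\<lambda>n. x n 0) \<circ> r) \<longlonglongrightarrow> x0"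
      using compact_Icc[of "-M" M] unfolding compact_def by meson
    have mr: "(\<lambda>n. m (r n)) \<longlonglongrightarrow> l" using LIMSEQ_subseq_LIMSEQ[OF ml r(1)] by (simp add: comp_def)
    have lim: "(\<lambda>n. U (\<lambda>t. h t + m (r n)) 0 (x (r n) 0) t) \<longlonglongrightarrow> U (\<lambda>t. h t + l) 0 x0 t" for t
    proof -
      have "(\<lambda>n. U (\<lambda>t. h t + m (r n)) 0 0 t + x (r n) 0 *
          (U (\<lambda>t. h t + m (r n)) 0 1 t - U (\<lambda>t. h t + m (r n)) 0 0 t))
        \<longlonglongrightarrow> U (\<lambda>t. h t + l) 0 0 t + x0 * (U (\<lambda>t. h t + l) 0 1 t - U (\<lambda>t. h t + l) 0 0 t)"
        using r(2) by (intro tendsto_intros U_param_limit[OF h mr]) (simp add: comp_def)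
      then show ?thesis
        by (subst U_affine[OF H, of _ 0 x0 t], subst U_affine[OF H, of _ 0 "x _ 0" t]) simp
    qed
    have "U (\<lambda>t. h t + m (r n)) 0 (x (r n) 0) t > 0" for n t
      using riccati_left(1)[OF H riccati_subset[OF x], of t 0 t] riccati_right(1)[OF H riccati_subset[OF x], of 0 t t]
      by (cases "t \<le> 0") auto
    then have "U (\<lambda>t. h t + l) 0 x0 t \<ge> 0" for t
      by (intro LIMSEQ_le_const[OF lim]) (auto intro: less_imp_le)
    then have "U (\<lambda>t. h t + l) 0 x0 t > 0" for t
      by (intro U_nonneg_imp_pos[OF H, of UNIV]) auto
    then have "riccati (\<lambda>t. h t + l) (\<lambda>t. V (\<lambda>t. h t + l) 0 x0 t / U (\<lambda>t. h t + l) 0 x0 t) UNIV"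
      by (intro riccati_lin[OF H]) (metis less_irrefl)
    then show ?thesis by (auto simp: S_def)
  qed
  moreover have "l \<le> m" if "m \<in> S" for m using S that by (auto simp: l_def intro: cInf_lower)
  ultimately have "\<forall>m. m \<in> S \<longleftrightarrow> l \<le> m" using up by blast
  then have "\<forall>m. (\<exists>x. riccati (\<lambda>t. h t + m) x UNIV) \<longleftrightarrow> l \<le> m" by (simp add: S_def)
  then show ?thesis
  proof (rule ex1I)
    fix l' assume "\<forall>m. (\<exists>x. riccati (\<lambda>t. h t + m) x UNIV) \<longleftrightarrow> l' \<le> m"
    with \<open>\<forall>m. (\<exists>x. riccati (\<lambda>t. h t + m) x UNIV) \<longleftrightarrow> l \<le> m\<close> show "l' = l"
      by (meson order_antisym order_refl)
  qed
qed

text \<open>Let \<open>R\<close> be the minimal global solution, obtained by reflection. If it differed from the maximal one,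
both ends of the line would separate the two uniformly, and their mean would be a global lower solution
for \<open>g - e\<^sup>2/4\<close>.\<close>

lemma amax_eq_at_threshold:
  assumes h: "bcont h" and g: "bcont g"
    and x1: "riccati h x1 UNIV" and x2: "riccati h x2 UNIV"
    and gap: "\<And>t. \<epsilon> \<le> x1 t - x2 t" and \<epsilon>: "\<epsilon> > 0"
    and close: "\<And>\<eta>. \<eta> > 0 \<Longrightarrow> \<exists>T. \<forall>t. \<bar>t\<bar> \<ge> T \<longrightarrow> \<bar>g t - h t\<bar> \<le> \<eta>"
    and \<beta>: "riccati g \<beta> UNIV" and minimal: "\<And>m x. m < 0 \<Longrightarrow> \<not> riccati (\<lambda>t. g t + m) x UNIV"
  shows "amax g t = \<beta> t"
proof (rule ccontr)
  assume neq: "amax g t \<noteq> \<beta> t"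
  let ?r = "\<lambda>f :: real \<Rightarrow> real. \<lambda>t. f (- t)"
  let ?mr = "\<lambda>f :: real \<Rightarrow> real. \<lambda>t. - f (- t)"
  have refl: "riccati (?r f) (?mr x) UNIV" if "riccati f x UNIV" for f x
    using riccati_reflect[OF that] by simp
  have all: "riccati f (amax f) UNIV" if f: "bcont f" and x: "riccati f x UNIV" for f x
    unfolding riccati_def
    using amax_riccati[OF f riccati_pos_left[OF f riccati_subset[OF x]]] by (auto simp: riccati_def)
  have le: "x s \<le> amax f s" if f: "bcont f" and x: "riccati f x UNIV" for f x s
    by (rule riccati_le_amax[OF f riccati_subset[OF x]]) simp
  define R where "R = ?mr (amax (?r g))"
  have A: "riccati g (amax g) UNIV" by (rule all[OF g \<beta>])
  have g': "bcont (?r g)" by (rule bcont_reflect[OF g])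
  have "riccati (?r (?r g)) R UNIV" unfolding R_def by (rule refl[OF all[OF g' refl[OF \<beta>]]])
  then have R: "riccati g R UNIV" by simp
  have "R t \<le> \<beta> t" using le[OF g' refl[OF \<beta>], of "- t"] by (simp add: R_def)
  with neq le[OF g \<beta>, of t] have "R t < amax g t" by simp
  then have R0: "R 0 < amax g 0"
    using riccati_order[OF _ riccati_subset[OF A] riccati_subset[OF R], of t 0]
      riccati_order[OF _ riccati_subset[OF A] riccati_subset[OF R], of 0 t]
    by (cases "t \<le> 0") (auto simp: sgn_if split: if_splits)
  have "7 / 64 * \<epsilon>\<^sup>2 > 0" using \<epsilon> by simp
  then obtain T where T: "\<And>t. \<bar>t\<bar> \<ge> T \<Longrightarrow> \<bar>g t - h t\<bar> \<le> 7 / 64 * \<epsilon>\<^sup>2" using close by blast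
  obtain e1 where e1: "e1 > 0" "\<And>t. t \<le> 0 \<Longrightarrow> e1 \<le> amax g t - R t"
    by (rule amax_separated[OF h g riccati_subset[OF x1] riccati_subset[OF x2] gap \<epsilon> _ riccati_subset[OF R] R0, of "- \<bar>T\<bar>"])
      (use T in auto)
  have R0': "?mr (amax g) 0 < amax (?r g) 0" using R0 by (simp add: R_def)
  have gap': "\<epsilon> \<le> ?mr x2 t - ?mr x1 t" for t using gap[of "- t"] by simp
  obtain e2 where e2: "e2 > 0" "\<And>t. t \<le> 0 \<Longrightarrow> e2 \<le> amax (?r g) t - ?mr (amax g) t"
    by (rule amax_separated[OF bcont_reflect[OF h] g' riccati_subset[OF refl[OF x2]]
          riccati_subset[OF refl[OF x1]] gap' \<epsilon> _ riccati_subset[OF refl[OF A]] R0', of "- \<bar>T\<bar>"])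
      (use T in auto)
  define e where "e = min e1 e2"
  have e: "e > 0" "e \<le> amax g t - R t" for t
  proof -
    show "e > 0" using e1 e2 by (simp add: e_def)
    show "e \<le> amax g t - R t" using e1(2)[of t] e2(2)[of "- t"] by (cases "t \<le> 0") (auto simp: e_def R_def)
  qed
  \<comment> \<open>The mean of the two extremal solutions is a lower solution with margin e^2/4.\<close>
  have "\<exists>x. riccati (\<lambda>t. g t + - (1 / 4 * e\<^sup>2)) x UNIV"
  proof (rule global_lower_solution[OF bcont_add_const[OF g] mix_derivative[OF A R UNIV_I, of "1 / 2"]])
    fix t
    have "e\<^sup>2 \<le> (amax g t - R t)\<^sup>2" using e by (intro power_mono) auto
    then show "g t - ((1 - 1 / 2) * amax g t + 1 / 2 * R t)\<^sup>2 - 1 / 2 * (1 - 1 / 2) * (amax g t - R t)\<^sup>2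
      \<le> g t + - (1 / 4 * e\<^sup>2) - ((1 - 1 / 2) * amax g t + 1 / 2 * R t)\<^sup>2" by simp
  qed
  with minimal[of "- (1 / 4 * e\<^sup>2)"] e(1) show False by simp
qed

section \<open>Two hyperbolic solutions are uniformly separated\<close>

text \<open>The reciprocal \<open>e = 1/(x\<^sub>1 - x\<^sub>2)\<close> of the distance solves \<open>e' = 2 x\<^sub>2 e + 1\<close>. The exponential decay
of \<open>exp (2 \<integral> x\<^sub>2)\<close> towards the future makes \<open>e\<close> bounded there.\<close>

lemma dichotomy_separated_right:
  assumes x1: "riccati p x1 UNIV" and x2: "riccati p x2 UNIV" and less: "\<And>t. x2 t < x1 t"
    and B: "\<And>t. (B has_real_derivative x2 t) (at t)"
    and decay: "\<And>s t. s \<le> t \<Longrightarrow> B t - B s \<le> \<gamma> - \<kappa> * (t - s)" and \<kappa>: "\<kappa> > 0"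
  shows "\<exists>\<epsilon>>0. \<forall>t\<ge>0. \<epsilon> \<le> x1 t - x2 t"
proof -
  define e where "e t = 1 / (x1 t - x2 t)" for t
  have epos: "e t > 0" for t using less[of t] by (simp add: e_def)
  have de: "(e has_real_derivative 2 * x2 t * e t + 1) (at t)" for t
  proof -
    have "((\<lambda>t. x1 t - x2 t) has_real_derivative - (x1 t + x2 t) * (x1 t - x2 t)) (at t)"
      by (auto intro!: derivative_eq_intros riccatiD[OF x1] riccatiD[OF x2] simp: algebra_simps power2_eq_square)
    from DERIV_divide[OF DERIV_const[of 1] this]
    have "(e has_real_derivative (0 * (x1 t - x2 t) - 1 * (- (x1 t + x2 t) * (x1 t - x2 t))) /
        ((x1 t - x2 t) * (x1 t - x2 t))) (at t)"
      using less[of t] unfolding e_def by force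
    moreover have "(0 * (x1 t - x2 t) - 1 * (- (x1 t + x2 t) * (x1 t - x2 t))) /
        ((x1 t - x2 t) * (x1 t - x2 t)) = 2 * x2 t * e t + 1"
    proof -
      have "0 * (x1 t - x2 t) - 1 * (- (x1 t + x2 t) * (x1 t - x2 t)) =
        (2 * x2 t + (x1 t - x2 t)) * (x1 t - x2 t)" by (simp add: algebra_simps)
      then have "(0 * (x1 t - x2 t) - 1 * (- (x1 t + x2 t) * (x1 t - x2 t))) /
        ((x1 t - x2 t) * (x1 t - x2 t)) = (2 * x2 t + (x1 t - x2 t)) / (x1 t - x2 t)"
        using less[of t] by simp
      also have "\<dots> = 2 * x2 t * e t + 1"
        using less[of t] by (simp only: add_divide_distrib) (simp add: e_def)
      finally show ?thesis .
    qed
    ultimately show ?thesis by simp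
  qed
  define C where "C = exp (2 * \<gamma>) * (e 0 + 1 / (2 * \<kappa>))"
  have C: "C > 0" using epos[of 0] \<kappa> by (simp add: C_def add_pos_pos)
  have "e t \<le> C" if t: "0 \<le> t" for t
  proof -
    \<comment> \<open>Variation of constants as a monotonicity statement: the last term integrates the decay bound.\<close>
    define H where "H \<tau> = e \<tau> * exp (- 2 * B \<tau>) - exp (2 * \<gamma> - 2 * B t) * exp (- 2 * \<kappa> * (t - \<tau>)) / (2 * \<kappa>)" for \<tau>
    have "H 0 \<ge> H t"
    proof (rule DERIV_nonpos_imp_nonincreasing[OF t])
      fix \<tau> assume \<tau>: "0 \<le> \<tau>" "\<tau> \<le> t"
      have "(H has_real_derivative exp (- 2 * B \<tau>) - exp (2 * \<gamma> - 2 * B t) * exp (- 2 * \<kappa> * (t - \<tau>))) (at \<tau>)"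
        unfolding H_def using \<kappa> by (auto intro!: derivative_eq_intros de B simp: algebra_simps)
      moreover have "exp (- 2 * B \<tau>) \<le> exp (2 * \<gamma> - 2 * B t) * exp (- 2 * \<kappa> * (t - \<tau>))"
        using decay[OF \<tau>(2)] by (simp add: exp_add[symmetric])
      ultimately show "\<exists>y. (H has_real_derivative y) (at \<tau>) \<and> y \<le> 0" by (meson diff_le_0_iff_le)
    qed
    moreover have "e 0 * exp (- 2 * B 0) \<le> e 0 * exp (2 * \<gamma> - 2 * B t)"
    proof -
      have "0 \<le> \<kappa> * t" using \<kappa> t by simp
      then have "- 2 * B 0 \<le> 2 * \<gamma> - 2 * B t" using decay[OF t] by simp
      then show ?thesis using epos[of 0] by simp
    qed
    moreover have "exp (2 * \<gamma> - 2 * B t) * exp (- 2 * \<kappa> * t) / (2 * \<kappa>) \<ge> 0" using \<kappa> by simp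
    ultimately have "e t * exp (- 2 * B t) \<le> e 0 * exp (2 * \<gamma> - 2 * B t) + exp (2 * \<gamma> - 2 * B t) / (2 * \<kappa>)"
      unfolding H_def by simp
    also have "\<dots> = C * exp (- 2 * B t)"
    proof -
      have "exp (2 * \<gamma> - 2 * B t) = exp (2 * \<gamma>) * exp (- 2 * B t)" by (simp add: exp_add[symmetric])
      then show ?thesis by (simp add: C_def algebra_simps)
    qed
    finally show ?thesis by simp
  qed
  then have "1 / C \<le> x1 t - x2 t" if "0 \<le> t" for t
  proof -
    have "1 \<le> C * (x1 t - x2 t)"
      using \<open>\<And>t. 0 \<le> t \<Longrightarrow> e t \<le> C\<close>[OF that] less[of t] by (simp add: e_def pos_divide_le_eq)
    then show ?thesis using C by (simp add: pos_divide_le_eq mult.commute)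
  qed
  then show ?thesis using C by (intro exI[of _ "1 / C"]) auto
qed

text \<open>The linearisation of \<open>-x\<^sup>2 + p\<close> along \<open>b\<close> is \<open>-2 b\<close>, so hyperbolicity is a linear growth or decay
bound for an antiderivative of \<open>b\<close>: growth for the attractive kind, decay for the repulsive kind.\<close>

lemma hyperbolic_exponents:
  assumes p: "continuous_on UNIV p" and b: "hyperbolic_solution (\<lambda>t x. - x\<^sup>2 + p t) b"
  obtains B \<gamma> \<kappa> where "riccati p b UNIV" "\<And>t. (B has_real_derivative b t) (at t)" "\<kappa> > 0"
    "(\<forall>s t. s \<le> t \<longrightarrow> \<kappa> * (t - s) - \<gamma> \<le> B t - B s) \<or> (\<forall>s t. s \<le> t \<longrightarrow> B t - B s \<le> \<gamma> - \<kappa> * (t - s))"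
proof -
  have ric: "riccati p b UNIV"
    using b by (auto simp: hyperbolic_solution_def global_solution_def riccati_def)
  have bc: "continuous_on UNIV b" by (rule riccati_continuous[OF ric])
  obtain B where B: "\<And>t. (B has_real_derivative b t) (at t)"
    using antiderivative_exists[OF bc] by metis
  have drv: "deriv (\<lambda>x. - x\<^sup>2 + p l) (b l) = - 2 * b l" for l
    by (rule DERIV_imp_deriv) (auto intro!: derivative_eq_intros)
  have int: "(LBINT l=ereal s..ereal t. - 2 * b l) = - 2 * B t - (- 2 * B s)" for s t
  proof (rule interval_integral_FTC_finite)
    show "continuous_on {min s t..max s t} (\<lambda>l. - 2 * b l)"
      by (intro continuous_intros continuous_on_subset[OF bc]) auto
    show "((\<lambda>t. - 2 * B t) has_vector_derivative - 2 * b x) (at x within {min s t..max s t})" for x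
      unfolding has_real_derivative_iff_has_vector_derivative[symmetric]
      by (rule has_field_derivative_at_within) (auto intro!: derivative_eq_intros B)
  qed
  obtain k \<beta> where k: "k \<ge> 1" "\<beta> > 0" and
    alt: "(\<forall>s t. t \<ge> s \<longrightarrow> exp (- 2 * B t - (- 2 * B s)) \<le> k * exp (- \<beta> * (t - s))) \<or>
      (\<forall>s t. t \<le> s \<longrightarrow> exp (- 2 * B t - (- 2 * B s)) \<le> k * exp (\<beta> * (t - s)))"
    using b unfolding hyperbolic_solution_def drv int by blast
  have log: "a \<le> ln k + c" if "exp a \<le> k * exp c" for a c
  proof -
    have "exp a \<le> exp (ln k + c)" using that k by (simp add: exp_add)
    then show ?thesis by simp
  qed
  show ?thesis
  proof (rule that[OF ric B, of "\<beta> / 2" "ln k / 2"])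
    show "\<beta> / 2 > 0" using k by simp
    from alt show "(\<forall>s t. s \<le> t \<longrightarrow> \<beta> / 2 * (t - s) - ln k / 2 \<le> B t - B s) \<or>
      (\<forall>s t. s \<le> t \<longrightarrow> B t - B s \<le> ln k / 2 - \<beta> / 2 * (t - s))"
    proof (elim disjE)
      assume a: "\<forall>s t. t \<ge> s \<longrightarrow> exp (- 2 * B t - (- 2 * B s)) \<le> k * exp (- \<beta> * (t - s))"
      have "\<beta> / 2 * (t - s) - ln k / 2 \<le> B t - B s" if "s \<le> t" for s t
        using log[OF a[rule_format, OF that]] by (simp add: field_simps)
      then show ?thesis by blast
    next
      assume a: "\<forall>s t. t \<le> s \<longrightarrow> exp (- 2 * B t - (- 2 * B s)) \<le> k * exp (\<beta> * (t - s))"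
      have "B t - B s \<le> ln k / 2 - \<beta> / 2 * (t - s)" if "s \<le> t" for s t
        using log[OF a[rule_format, OF that]] by (simp add: field_simps)
      then show ?thesis by blast
    qed
  qed
qed

text \<open>Let \<open>y\<^sub>1 > y\<^sub>2\<close>. The distance satisfies \<open>d' = - (y\<^sub>1 + y\<^sub>2) d\<close>. If both solutions are attractive or both
repulsive, \<open>d\<close> grows exponentially in one time direction, against its boundedness; if the upper one
is repulsive and the lower one attractive, \<open>\<integral> (y\<^sub>1 - y\<^sub>2)\<close> decreases. So the upper solution is
attractive and the lower one repulsive, and the dichotomies bound \<open>1/d\<close> in both directions.\<close>

lemma hyperbolic_pair_separated:
  assumes p: "bcont p" and hyp1: "hyperbolic_solution (\<lambda>t x. - x\<^sup>2 + p t) x1"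
    and hyp2: "hyperbolic_solution (\<lambda>t x. - x\<^sup>2 + p t) x2" and neq: "x1 \<noteq> x2"
  obtains y1 y2 \<epsilon> where "riccati p y1 UNIV" "riccati p y2 UNIV" "\<epsilon> > 0" "\<And>t. \<epsilon> \<le> y1 t - y2 t"
proof -
  have pc: "continuous_on UNIV p" using p by (simp add: bcont_def)
  obtain y1 y2 where hyp: "hyperbolic_solution (\<lambda>t x. - x\<^sup>2 + p t) y1"
      "hyperbolic_solution (\<lambda>t x. - x\<^sup>2 + p t) y2" and ex: "\<exists>t. y2 t < y1 t"
    using assms by (metis ext linorder_neqE_linordered_idom)
  obtain B1 \<gamma>1 \<kappa>1 where 1: "riccati p y1 UNIV" "\<And>t. (B1 has_real_derivative y1 t) (at t)" "\<kappa>1 > 0"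
    and alt1: "(\<forall>s t. s \<le> t \<longrightarrow> \<kappa>1 * (t - s) - \<gamma>1 \<le> B1 t - B1 s) \<or> (\<forall>s t. s \<le> t \<longrightarrow> B1 t - B1 s \<le> \<gamma>1 - \<kappa>1 * (t - s))"
    using hyperbolic_exponents[OF pc hyp(1)] by metis
  obtain B2 \<gamma>2 \<kappa>2 where 2: "riccati p y2 UNIV" "\<And>t. (B2 has_real_derivative y2 t) (at t)" "\<kappa>2 > 0"
    and alt2: "(\<forall>s t. s \<le> t \<longrightarrow> \<kappa>2 * (t - s) - \<gamma>2 \<le> B2 t - B2 s) \<or> (\<forall>s t. s \<le> t \<longrightarrow> B2 t - B2 s \<le> \<gamma>2 - \<kappa>2 * (t - s))"
    using hyperbolic_exponents[OF pc hyp(2)] by metis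
  have less: "y2 t < y1 t" for t
  proof -
    obtain s where "y2 s < y1 s" using ex by blast
    then show ?thesis
      using riccati_order[OF _ riccati_subset[OF 1(1)] riccati_subset[OF 2(1)], of t s]
        riccati_order[OF _ riccati_subset[OF 1(1)] riccati_subset[OF 2(1)], of s t]
      by (cases "t \<le> s") (auto simp: sgn_if split: if_splits)
  qed
  define d where "d t = y1 t - y2 t" for t
  have dpos: "d t > 0" for t using less[of t] by (simp add: d_def)
  obtain M where M: "M \<ge> 0" "\<And>t. \<bar>p t\<bar> \<le> M\<^sup>2" using bcont_square_bound[OF p] by blast
  have dM: "d t \<le> 2 * M" for t
    using riccati_global_bound[OF 1(1) M(1), of t] riccati_global_bound[OF 2(1) M(1), of t] M(2)
    by (simp add: d_def abs_le_iff)
  have dexp: "d t = d s * exp (- (B1 t - B1 s) - (B2 t - B2 s))" for s t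
  proof -
    define F where "F t = d t * exp (B1 t + B2 t)" for t
    have "(F has_real_derivative 0) (at t)" for t
      unfolding F_def d_def
      by (auto intro!: derivative_eq_intros 1(2) 2(2) riccatiD[OF 1(1)] riccatiD[OF 2(1)] simp: algebra_simps power2_eq_square)
    then have "F t = F s" using DERIV_isconst_all by blast
    then have "d t = d s * exp (B1 s + B2 s) / exp (B1 t + B2 t)" by (simp add: F_def field_simps)
    also have "\<dots> = d s * exp ((B1 s + B2 s) - (B1 t + B2 t))" by (simp add: exp_diff)
    finally show ?thesis by (simp add: algebra_simps)
  qed
  define \<kappa> where "\<kappa> = \<kappa>1 + \<kappa>2"
  define \<gamma> where "\<gamma> = \<gamma>1 + \<gamma>2"
  have \<kappa>: "\<kappa> > 0" using 1(3) 2(3) by (simp add: \<kappa>_def)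
  \<comment> \<open>After time T exponential growth from d 0 exceeds 2 M, the a priori bound for d.\<close>
  define T where "T = max 0 ((2 * M / d 0 + \<gamma>) / \<kappa>)"
  have T0: "T \<ge> 0" by (simp add: T_def)
  have "2 * M / d 0 + \<gamma> \<le> T * \<kappa>" using \<kappa> by (simp add: T_def pos_divide_le_eq[symmetric])
  then have "2 * M / d 0 < exp (\<kappa> * T - \<gamma>)"
    using exp_ge_add_one_self[of "\<kappa> * T - \<gamma>"] mult.commute[of T \<kappa>] by linarith
  then have T: "2 * M < d 0 * exp (\<kappa> * T - \<gamma>)" using dpos[of 0] by (simp add: pos_divide_less_eq mult.commute)
  have not_att: False if a1: "\<forall>s t. s \<le> t \<longrightarrow> \<kappa>1 * (t - s) - \<gamma>1 \<le> B1 t - B1 s"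
    and a2: "\<forall>s t. s \<le> t \<longrightarrow> \<kappa>2 * (t - s) - \<gamma>2 \<le> B2 t - B2 s"
  proof -
    have "\<kappa> * T - \<gamma> \<le> - (B1 (- T) - B1 0) - (B2 (- T) - B2 0)"
    proof -
      have "\<kappa>1 * T - \<gamma>1 \<le> B1 0 - B1 (- T)" "\<kappa>2 * T - \<gamma>2 \<le> B2 0 - B2 (- T)"
        using a1[rule_format, of "- T" 0] a2[rule_format, of "- T" 0] T0 by simp_all
      moreover have "\<kappa> * T = \<kappa>1 * T + \<kappa>2 * T" by (simp add: \<kappa>_def distrib_right)
      ultimately show ?thesis unfolding \<gamma>_def by linarith
    qed
    then have "d 0 * exp (\<kappa> * T - \<gamma>) \<le> d 0 * exp (- (B1 (- T) - B1 0) - (B2 (- T) - B2 0))"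
      using dpos[of 0] by simp
    also have "\<dots> = d (- T)" by (rule dexp[symmetric])
    finally have "d 0 * exp (\<kappa> * T - \<gamma>) \<le> d (- T)" .
    with T dM[of "- T"] show False by simp
  qed
  have not_rep: False if a1: "\<forall>s t. s \<le> t \<longrightarrow> B1 t - B1 s \<le> \<gamma>1 - \<kappa>1 * (t - s)"
    and a2: "\<forall>s t. s \<le> t \<longrightarrow> B2 t - B2 s \<le> \<gamma>2 - \<kappa>2 * (t - s)"
  proof -
    have "\<kappa> * T - \<gamma> \<le> - (B1 T - B1 0) - (B2 T - B2 0)"
    proof -
      have "B1 T - B1 0 \<le> \<gamma>1 - \<kappa>1 * T" "B2 T - B2 0 \<le> \<gamma>2 - \<kappa>2 * T"
        using a1[rule_format, of 0 T] a2[rule_format, of 0 T] T0 by simp_all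
      moreover have "\<kappa> * T = \<kappa>1 * T + \<kappa>2 * T" by (simp add: \<kappa>_def distrib_right)
      ultimately show ?thesis unfolding \<gamma>_def by linarith
    qed
    then have "d 0 * exp (\<kappa> * T - \<gamma>) \<le> d 0 * exp (- (B1 T - B1 0) - (B2 T - B2 0))"
      using dpos[of 0] by simp
    also have "\<dots> = d T" by (rule dexp[symmetric])
    finally have "d 0 * exp (\<kappa> * T - \<gamma>) \<le> d T" .
    with T dM[of T] show False by simp
  qed
  have not_swapped: False if a1: "\<forall>s t. s \<le> t \<longrightarrow> B1 t - B1 s \<le> \<gamma>1 - \<kappa>1 * (t - s)"
    and a2: "\<forall>s t. s \<le> t \<longrightarrow> \<kappa>2 * (t - s) - \<gamma>2 \<le> B2 t - B2 s"
  proof -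
    \<comment> \<open>A time by which the two exponential bounds together outweigh the constants \<gamma>1 and \<gamma>2.\<close>
    define S where "S = max 0 ((\<gamma> + 1) / \<kappa>)"
    have S: "S \<ge> 0" by (simp add: S_def)
    have "\<gamma> + 1 \<le> S * \<kappa>" using \<kappa> by (simp add: S_def pos_divide_le_eq[symmetric])
    moreover have "B1 0 - B2 0 \<le> B1 S - B2 S"
    proof (rule DERIV_nonneg_imp_nondecreasing[OF S, of "\<lambda>t. B1 t - B2 t"])
      fix t show "\<exists>y. ((\<lambda>t. B1 t - B2 t) has_real_derivative y) (at t) \<and> 0 \<le> y"
        using DERIV_diff[OF 1(2) 2(2), of t] less[of t] by (intro exI[of _ "y1 t - y2 t"]) auto
    qed
    moreover have "B1 S - B1 0 \<le> \<gamma>1 - \<kappa>1 * S" "\<kappa>2 * S - \<gamma>2 \<le> B2 S - B2 0"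
      using a1[rule_format, OF S] a2[rule_format, OF S] by simp_all
    moreover have "S * \<kappa> = \<kappa>1 * S + \<kappa>2 * S" by (simp add: \<kappa>_def algebra_simps)
    ultimately show False unfolding \<gamma>_def by linarith
  qed
  have att: "\<forall>s t. s \<le> t \<longrightarrow> \<kappa>1 * (t - s) - \<gamma>1 \<le> B1 t - B1 s" using alt1 alt2 not_swapped not_rep by blast
  have rep: "\<And>s t. s \<le> t \<Longrightarrow> B2 t - B2 s \<le> \<gamma>2 - \<kappa>2 * (t - s)" using att alt2 not_att by blast
  obtain e1 where e1: "e1 > 0" "\<forall>t\<ge>0. e1 \<le> y1 t - y2 t"
    using dichotomy_separated_right[OF 1(1) 2(1) less 2(2) rep 2(3)] by blast
  have "\<exists>\<epsilon>>0. \<forall>t\<ge>0. \<epsilon> \<le> - y2 (- t) - - y1 (- t)"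
  proof (rule dichotomy_separated_right[where B = "\<lambda>t. B1 (- t)" and \<gamma> = \<gamma>1 and \<kappa> = \<kappa>1])
    show "riccati (\<lambda>t. p (- t)) (\<lambda>t. - y2 (- t)) UNIV" "riccati (\<lambda>t. p (- t)) (\<lambda>t. - y1 (- t)) UNIV"
      using riccati_reflect[OF 1(1)] riccati_reflect[OF 2(1)] by simp_all
    show "((\<lambda>t. B1 (- t)) has_real_derivative - y1 (- t)) (at t)" for t
      using 1(2)[of "- t"] by (simp add: DERIV_mirror)
    show "B1 (- t) - B1 (- s) \<le> \<gamma>1 - \<kappa>1 * (t - s)" if "s \<le> t" for s t
      using att[rule_format, of "- t" "- s"] that by simp
  qed (use less 1(3) in auto)
  then obtain e2 where e2: "e2 > 0" "\<forall>t\<ge>0. e2 \<le> y1 (- t) - y2 (- t)" by auto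
  show ?thesis
  proof (rule that[OF 1(1) 2(1), of "min e1 e2"])
    show "min e1 e2 > 0" using e1 e2 by simp
    fix t show "min e1 e2 \<le> y1 t - y2 t"
      using e1(2) e2(2)[rule_format, of "- t"] by (cases "t \<ge> 0") auto
  qed
qed

section \<open>From the tipping equation to the Riccati equation\<close>

definition \<Gamma> :: "real \<Rightarrow> real \<Rightarrow> real" where "\<Gamma> c t = 2 / pi * arctan (c * t)"

definition drive :: "(real \<Rightarrow> real) \<Rightarrow> real \<Rightarrow> real \<Rightarrow> real" where "drive p c t = p t - q c t"

lemma q_den_pos: "pi * (c\<^sup>2 * t\<^sup>2 + 1) > 0"
  by (intro mult_pos_pos add_nonneg_pos) auto

lemma \<Gamma>_deriv: "(\<Gamma> c has_real_derivative q c t) (at t)"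
proof -
  have "(\<Gamma> c has_real_derivative 2 / pi * (c / (1 + (c * t)\<^sup>2))) (at t)"
    unfolding \<Gamma>_def by (auto intro!: derivative_eq_intros simp: divide_inverse)
  moreover have "2 / pi * (c / (1 + (c * t)\<^sup>2)) = q c t"
    by (simp add: q_def power_mult_distrib add.commute)
  ultimately show ?thesis by simp
qed

lemma \<Gamma>_bound: "\<bar>\<Gamma> c t\<bar> \<le> 1"
proof -
  have "\<bar>arctan (c * t)\<bar> \<le> pi / 2" using arctan_bounded[of "c * t"] by linarith
  then show ?thesis by (simp add: \<Gamma>_def abs_mult field_simps)
qed

lemma \<Gamma>_minus: "\<Gamma> c (- t) = - \<Gamma> c t"
  by (simp add: \<Gamma>_def arctan_minus)

text \<open>The derivative in \<open>c\<close> is \<open>(2/\<pi>) t/(1 + c\<^sup>2 t\<^sup>2)\<close>, and \<open>2 c \<bar>t\<bar> \<le> 1 + c\<^sup>2 t\<^sup>2\<close> bounds it uniformly in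
\<open>t\<close> as long as \<open>c\<close> stays away from \<open>0\<close>.\<close>

lemma \<Gamma>_lipschitz:
  assumes "c0 > 0" "c0 / 2 \<le> c"
  shows "\<bar>\<Gamma> c t - \<Gamma> c0 t\<bar> \<le> 1 / c0 * \<bar>c - c0\<bar>"
proof -
  have "norm (\<Gamma> c t - \<Gamma> c0 t) \<le> 1 / c0 * norm (c - c0)"
  proof (rule field_differentiable_bound[of "{c0 / 2..}" "\<lambda>c. \<Gamma> c t" "\<lambda>c. 2 / pi * (t / (1 + (c * t)\<^sup>2))"])
    fix \<xi> assume \<xi>: "\<xi> \<in> {c0 / 2..}"
    have "((\<lambda>c. \<Gamma> c t) has_real_derivative 2 / pi * (t / (1 + (\<xi> * t)\<^sup>2))) (at \<xi>)"
      unfolding \<Gamma>_def by (auto intro!: derivative_eq_intros simp: divide_inverse)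
    then show "((\<lambda>c. \<Gamma> c t) has_field_derivative 2 / pi * (t / (1 + (\<xi> * t)\<^sup>2))) (at \<xi> within {c0 / 2..})"
      by (rule has_field_derivative_at_within)
    have den: "1 + (\<xi> * t)\<^sup>2 > 0" by (simp add: add_pos_nonneg)
    have "c0 * \<bar>t\<bar> \<le> 2 * \<xi> * \<bar>t\<bar>" using \<xi> by (intro mult_right_mono) auto
    also have "\<dots> \<le> 1 + (\<xi> * t)\<^sup>2"
      using zero_le_power2[of "\<xi> * \<bar>t\<bar> - 1"] by (simp add: power2_diff power_mult_distrib)
    finally have "c0 * \<bar>t\<bar> \<le> 1 + (\<xi> * t)\<^sup>2" .
    then have "\<bar>t\<bar> / (1 + (\<xi> * t)\<^sup>2) \<le> 1 / c0"
    proof (intro mult_imp_div_pos_le[OF den])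
      show "\<bar>t\<bar> \<le> 1 / c0 * (1 + (\<xi> * t)\<^sup>2)"
        using \<open>c0 * \<bar>t\<bar> \<le> 1 + (\<xi> * t)\<^sup>2\<close> assms(1) by (simp add: pos_le_divide_eq mult.commute)
    qed
    then have "2 / pi * (\<bar>t\<bar> / (1 + (\<xi> * t)\<^sup>2)) \<le> 1 * (1 / c0)"
      using assms(1) pi_ge_two by (intro mult_mono) auto
    then show "norm (2 / pi * (t / (1 + (\<xi> * t)\<^sup>2))) \<le> 1 / c0"
      using den by (simp add: abs_mult)
  qed (use assms in auto)
  then show ?thesis by simp
qed

lemma q_lipschitz: "\<bar>q c t - q c' t\<bar> \<le> \<bar>c - c'\<bar>"
proof -
  define A where "A = c\<^sup>2 * t\<^sup>2 + 1"
  define B where "B = c'\<^sup>2 * t\<^sup>2 + 1"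
  have A: "A \<ge> 1" and B: "B \<ge> 1" by (simp_all add: A_def B_def)
  have eq: "q c t - q c' t = 2 / pi * ((c - c') * ((1 - c * c' * t\<^sup>2) / (A * B)))"
  proof -
    have "q c t - q c' t = 2 / pi * (c / A - c' / B)"
      unfolding q_def A_def[symmetric] B_def[symmetric] by (simp add: right_diff_distrib)
    also have "c / A - c' / B = (c * B - c' * A) / (A * B)" using A B by (simp add: diff_frac_eq)
    also have "c * B - c' * A = (c - c') * (1 - c * c' * t\<^sup>2)"
      by (simp add: A_def B_def algebra_simps power2_eq_square)
    finally show ?thesis by simp
  qed
  have "\<bar>1 - c * c' * t\<^sup>2\<bar> \<le> A * B"
  proof -
    have "2 * \<bar>c * c'\<bar> \<le> c\<^sup>2 + c'\<^sup>2"
      using zero_le_power2[of "\<bar>c\<bar> - \<bar>c'\<bar>"] by (simp add: power2_diff abs_mult)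
    then have "2 * \<bar>c * c'\<bar> * t\<^sup>2 \<le> (c\<^sup>2 + c'\<^sup>2) * t\<^sup>2" by (rule mult_right_mono) simp
    moreover have "\<bar>1 - c * c' * t\<^sup>2\<bar> \<le> 1 + \<bar>c * c'\<bar> * t\<^sup>2"
      using abs_triangle_ineq4[of 1 "c * c' * t\<^sup>2"] by (simp add: abs_mult)
    moreover have "(c\<^sup>2 + c'\<^sup>2) * t\<^sup>2 + 1 \<le> A * B"
      by (simp add: A_def B_def algebra_simps)
    moreover have "0 \<le> (c\<^sup>2 + c'\<^sup>2) * t\<^sup>2" by simp
    ultimately show ?thesis by linarith
  qed
  then have "\<bar>(1 - c * c' * t\<^sup>2) / (A * B)\<bar> \<le> 1" using A B by simp
  then have "\<bar>c - c'\<bar> * \<bar>(1 - c * c' * t\<^sup>2) / (A * B)\<bar> \<le> \<bar>c - c'\<bar> * 1"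
    by (rule mult_left_mono) simp
  then have "2 / pi * \<bar>(c - c') * ((1 - c * c' * t\<^sup>2) / (A * B))\<bar> \<le> 1 * \<bar>c - c'\<bar>"
    using pi_ge_two by (intro mult_mono) (auto simp: abs_mult)
  then show ?thesis unfolding eq by (simp add: abs_mult)
qed

lemma q_tail:
  assumes c: "c > 0" and \<eta>: "\<eta> > 0"
  shows "\<exists>T. \<forall>t. \<bar>t\<bar> \<ge> T \<longrightarrow> \<bar>q c t\<bar> \<le> \<eta>"
proof (intro exI allI impI)
  fix t assume t: "max 1 (1 / (c * \<eta>)) \<le> \<bar>t\<bar>"
  have "1 \<le> c * \<eta> * \<bar>t\<bar>" using t c \<eta> by (simp add: divide_le_eq mult.commute)
  also have "\<dots> \<le> c * \<eta> * t\<^sup>2"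
  proof -
    have "\<bar>t\<bar> * 1 \<le> \<bar>t\<bar> * \<bar>t\<bar>" using t by (intro mult_left_mono) auto
    then have "\<bar>t\<bar> \<le> t\<^sup>2" by (simp add: power2_eq_square)
    then show ?thesis using c \<eta> by (intro mult_left_mono) auto
  qed
  finally have "c * 1 \<le> c * (c * \<eta> * t\<^sup>2)" using c by (intro mult_left_mono) auto
  also have "\<dots> \<le> \<eta> * (c\<^sup>2 * t\<^sup>2 + 1)" using \<eta> by (simp add: algebra_simps power2_eq_square)
  finally have "2 * c \<le> 2 * (\<eta> * (c\<^sup>2 * t\<^sup>2 + 1))" by simp
  also have "\<dots> \<le> pi * (\<eta> * (c\<^sup>2 * t\<^sup>2 + 1))"
    using pi_ge_two \<eta> by (intro mult_right_mono) auto
  finally have "q c t \<le> \<eta>" unfolding q_def using q_den_pos[of c t]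
    by (simp add: pos_divide_le_eq mult.left_commute)
  moreover have "q c t \<ge> 0" unfolding q_def using q_den_pos[of c t] c by simp
  ultimately show "\<bar>q c t\<bar> \<le> \<eta>" by simp
qed

lemma bcont_drive:
  assumes "bcont p" shows "bcont (drive p c)"
proof -
  obtain K where K: "\<And>t. \<bar>p t\<bar> \<le> K" using bcontE[OF assms] by blast
  show ?thesis
  proof (rule bcontI)
    have "continuous_on UNIV (q c)" unfolding q_def
      using q_den_pos[of c] by (intro continuous_intros) (metis less_irrefl)
    then show "continuous_on UNIV (drive p c)"
      using assms unfolding drive_def bcont_def by (auto intro: continuous_intros)
    fix t
    have "\<bar>q c t\<bar> \<le> \<bar>c\<bar>" using q_lipschitz[of c t 0] by (simp add: q_def)
    then show "\<bar>drive p c t\<bar> \<le> K + \<bar>c\<bar>"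
      using K[of t] abs_triangle_ineq4[of "p t" "q c t"] unfolding drive_def by linarith
  qed
qed

lemma drive_reflect: "drive (\<lambda>t. p (- t)) c = (\<lambda>t. drive p c (- t))"
  by (simp add: drive_def q_def fun_eq_iff)

lemma E_deriv_iff:
  "(y has_real_derivative E p c t (y t)) (at t) \<longleftrightarrow>
   ((\<lambda>t. y t - \<Gamma> c t) has_real_derivative drive p c t - (y t - \<Gamma> c t)\<^sup>2) (at t)"
proof -
  have E: "E p c t (y t) = (drive p c t - (y t - \<Gamma> c t)\<^sup>2) + q c t"
    by (simp add: E_def drive_def \<Gamma>_def)
  show ?thesis
  proof
    assume "(y has_real_derivative E p c t (y t)) (at t)"
    from DERIV_diff[OF this \<Gamma>_deriv[of c]]
    show "((\<lambda>t. y t - \<Gamma> c t) has_real_derivative drive p c t - (y t - \<Gamma> c t)\<^sup>2) (at t)"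
      unfolding E by simp
  next
    assume "((\<lambda>t. y t - \<Gamma> c t) has_real_derivative drive p c t - (y t - \<Gamma> c t)\<^sup>2) (at t)"
    from DERIV_add[OF this \<Gamma>_deriv[of c t]]
    show "(y has_real_derivative E p c t (y t)) (at t)" unfolding E by simp
  qed
qed

lemma ivp_solution_iff:
  "ivp_solution (E p c) s y0 I y \<longleftrightarrow> open I \<and> is_interval I \<and> s \<in> I \<and> y s = y0 \<and>
     riccati (drive p c) (\<lambda>t. y t - \<Gamma> c t) I"
  unfolding ivp_solution_def riccati_def E_deriv_iff ..

text \<open>The maximal interval around \<open>s\<close> on which the Riccati solution \<open>u'/u\<close> is defined.\<close>

definition life :: "(real \<Rightarrow> real) \<Rightarrow> real \<Rightarrow> real \<Rightarrow> real set" where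
  "life h s x0 = connected_component_set {t. U h s x0 t > 0} s"

lemma life_properties:
  assumes h: "bcont h"
  shows "open (life h s x0)" "is_interval (life h s x0)" "s \<in> life h s x0"
    "t \<in> life h s x0 \<Longrightarrow> U h s x0 t > 0"
    "is_interval I \<Longrightarrow> s \<in> I \<Longrightarrow> (\<And>t. t \<in> I \<Longrightarrow> U h s x0 t > 0) \<Longrightarrow> I \<subseteq> life h s x0"
proof -
  have "continuous_on UNIV (U h s x0)"
    by (rule DERIV_continuous_on[OF has_field_derivative_at_within[OF U_deriv(1)[OF h]]])
  then have "open {t. U h s x0 t > 0}" by (intro open_Collect_less) auto
  then show "open (life h s x0)" unfolding life_def by (rule open_connected_component)
  show "is_interval (life h s x0)" unfolding life_def is_interval_connected_1 by (rule connected_connected_component)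
  show "s \<in> life h s x0" unfolding life_def by (simp add: lin_sol[OF h])
  show "t \<in> life h s x0 \<Longrightarrow> U h s x0 t > 0"
    unfolding life_def using connected_component_subset by blast
  show "is_interval I \<Longrightarrow> s \<in> I \<Longrightarrow> (\<And>t. t \<in> I \<Longrightarrow> U h s x0 t > 0) \<Longrightarrow> I \<subseteq> life h s x0"
    unfolding life_def is_interval_connected_1 by (rule connected_component_maximal) auto
qed

lemma riccati_interval:
  assumes h: "bcont h" and x: "riccati h x I" and I: "is_interval I" "s \<in> I" and t: "t \<in> I"
  shows "U h s (x s) t > 0" "x t = V h s (x s) t / U h s (x s) t"
proof -
  have "{s..t} \<subseteq> I" "{t..s} \<subseteq> I" using I t unfolding is_interval_1 by (meson atLeastAtMost_iff subsetI)+
  then show "U h s (x s) t > 0" "x t = V h s (x s) t / U h s (x s) t"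
    using riccati_right[OF h riccati_subset[OF x], of s t t] riccati_left[OF h riccati_subset[OF x], of t s t]
    by (cases "s \<le> t"; auto)+
qed

lemma life_solution:
  assumes p: "bcont p"
  shows "ivp_solution (E p c) s y0 (life (drive p c) s (y0 - \<Gamma> c s))
    (\<lambda>t. \<Gamma> c t + V (drive p c) s (y0 - \<Gamma> c s) t / U (drive p c) s (y0 - \<Gamma> c s) t)"
proof -
  note h = bcont_drive[OF p, of c]
  have "riccati (drive p c) (\<lambda>t. V (drive p c) s (y0 - \<Gamma> c s) t / U (drive p c) s (y0 - \<Gamma> c s) t)
      (life (drive p c) s (y0 - \<Gamma> c s))"
    by (rule riccati_lin[OF h]) (metis life_properties(4)[OF h] less_irrefl)
  then show ?thesis using life_properties(1-3)[OF h] by (simp add: ivp_solution_iff lin_sol[OF h])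
qed

lemma ivp_solution_unique:
  assumes p: "bcont p" and y: "ivp_solution (E p c) s y0 I y" and t: "t \<in> I"
  shows "t \<in> life (drive p c) s (y0 - \<Gamma> c s)"
    "y t = \<Gamma> c t + V (drive p c) s (y0 - \<Gamma> c s) t / U (drive p c) s (y0 - \<Gamma> c s) t"
proof -
  note h = bcont_drive[OF p, of c]
  have I: "is_interval I" "s \<in> I" and ys: "y s = y0" and ric: "riccati (drive p c) (\<lambda>t. y t - \<Gamma> c t) I"
    using y by (auto simp: ivp_solution_iff)
  note R = riccati_interval[OF h ric I, unfolded ys]
  show "t \<in> life (drive p c) s (y0 - \<Gamma> c s)"
    using life_properties(5)[OF h I R(1)] t by blast
  show "y t = \<Gamma> c t + V (drive p c) s (y0 - \<Gamma> c s) t / U (drive p c) s (y0 - \<Gamma> c s) t"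
    using R(2)[OF t] by simp
qed

lemma max_interval_eq:
  assumes p: "bcont p"
  shows "max_interval (E p c) s y0 = life (drive p c) s (y0 - \<Gamma> c s)"
  unfolding max_interval_def using ivp_solution_unique(1)[OF p] life_solution[OF p] by blast

lemma max_solution_eq:
  assumes p: "bcont p" and t: "t \<in> life (drive p c) s (y0 - \<Gamma> c s)"
  shows "max_solution (E p c) t s y0 =
    \<Gamma> c t + V (drive p c) s (y0 - \<Gamma> c s) t / U (drive p c) s (y0 - \<Gamma> c s) t"
  unfolding max_solution_def
proof (rule the_equality)
  show "\<exists>I x. ivp_solution (E p c) s y0 I x \<and> t \<in> I \<and>
      \<Gamma> c t + V (drive p c) s (y0 - \<Gamma> c s) t / U (drive p c) s (y0 - \<Gamma> c s) t = x t"
    using life_solution[OF p] t by blast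
  show "v = \<Gamma> c t + V (drive p c) s (y0 - \<Gamma> c s) t / U (drive p c) s (y0 - \<Gamma> c s) t"
    if "\<exists>I x. ivp_solution (E p c) s y0 I x \<and> t \<in> I \<and> v = x t" for v
    using that ivp_solution_unique(2)[OF p] by blast
qed

text \<open>A solution that is bounded above in the past cannot blow up there: if \<open>u'/u \<le> B\<close> on the maximal
interval, then \<open>u(t) exp (- B t)\<close> does not increase, so \<open>u\<close> is still positive at the left end point
\<open>\<alpha>\<close>, which would then belong to the interval. Conversely, solutions on \<open>(-\<infinity>, s]\<close> are automatically
bounded above.\<close>

lemma bounded_above_left_iff:
  assumes p: "bcont p"
  shows "bounded_above_left p c s y0 \<longleftrightarrow> pos_left (drive p c) s (y0 - \<Gamma> c s)"
proof -
  define x0 where "x0 = y0 - \<Gamma> c s"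
  define u where "u = U (drive p c) s x0"
  define v where "v = V (drive p c) s x0"
  define L where "L = life (drive p c) s x0"
  note h = bcont_drive[OF p, of c]
  note L = life_properties[OF h, where s=s and ?x0.0=x0, folded L_def u_def]
  have u: "(u has_real_derivative v t) (at t)" for t unfolding u_def v_def by (rule U_deriv[OF h])
  have us: "u s = 1" unfolding u_def by (rule lin_sol[OF h])
  have "bounded_above_left p c s y0 \<longleftrightarrow> bdd_above ((\<lambda>t. \<Gamma> c t + v t / u t) ` (L \<inter> {..s}))"
    unfolding bounded_above_left_def max_interval_eq[OF p] x0_def[symmetric] L_def[symmetric]
    by (rule arg_cong[where f=bdd_above], rule image_cong)
      (auto simp: max_solution_eq[OF p] x0_def u_def v_def L_def)
  also have "\<dots> \<longleftrightarrow> pos_left (drive p c) s x0"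
  proof
    assume pl: "pos_left (drive p c) s x0"
    obtain M where M: "M \<ge> 0" "\<And>t. \<bar>drive p c t\<bar> \<le> M\<^sup>2" using bcont_square_bound[OF h] by blast
    have "\<Gamma> c t + v t / u t \<le> 1 + M" if "t \<le> s" for t
    proof -
      have "v t / u t \<le> M" unfolding u_def v_def
        by (rule riccati_upper[OF riccati_subset[OF pos_left_riccati(1)[OF h pl]] M(1)])
          (use M(2) that in \<open>auto simp: abs_le_iff\<close>)
      then show ?thesis using \<Gamma>_bound[of c t] by (simp add: abs_le_iff)
    qed
    then show "bdd_above ((\<lambda>t. \<Gamma> c t + v t / u t) ` (L \<inter> {..s}))" by (auto simp: bdd_above_def)
  next
    assume "bdd_above ((\<lambda>t. \<Gamma> c t + v t / u t) ` (L \<inter> {..s}))"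
    then obtain B0 where B0: "\<And>t. t \<in> L \<Longrightarrow> t \<le> s \<Longrightarrow> \<Gamma> c t + v t / u t \<le> B0"
      by (auto simp: bdd_above_def)
    define B where "B = B0 + 1"
    have B: "v t \<le> B * u t" if "t \<in> L" "t \<le> s" for t
    proof -
      have "v t / u t \<le> B" using B0[OF that] \<Gamma>_bound[of c t] unfolding B_def by linarith
      then show ?thesis using L(4)[OF that(1)] by (simp add: pos_divide_le_eq)
    qed
    show "pos_left (drive p c) s x0"
    proof (rule ccontr)
      assume "\<not> pos_left (drive p c) s x0"
      then obtain t0 where t0: "t0 \<le> s" "\<not> u t0 > 0" by (auto simp: pos_left_def u_def)
      have lb: "t0 \<le> t" if "t \<in> L" for t
      proof (rule ccontr)
        assume "\<not> t0 \<le> t"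
        then have "t0 \<in> L" using L(2,3) that t0(1) unfolding is_interval_1 by (meson linear order.trans)
        with L(4) t0 show False by blast
      qed
      define \<alpha> where "\<alpha> = Inf L"
      have bdd: "bdd_below L" using lb by (auto simp: bdd_below_def)
      have \<alpha>s: "\<alpha> \<le> s" unfolding \<alpha>_def by (rule cInf_lower[OF L(3) bdd])
      have in_L: "t \<in> L" if t: "\<alpha> < t" "t \<le> s" for t
      proof -
        have "L \<noteq> {}" using L(3) by blast
        from cInf_lessD[OF this t(1)[unfolded \<alpha>_def]] obtain r where "r \<in> L" "r < t" by blast
        then show ?thesis using L(2,3) t(2) unfolding is_interval_1 by (meson less_imp_le)
      qed
      have "\<alpha> \<notin> L"
      proof
        assume "\<alpha> \<in> L"
        then obtain e where "e > 0" "\<And>y. \<bar>y - \<alpha>\<bar> < e \<Longrightarrow> y \<in> L"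
          using L(1) unfolding open_dist dist_real_def by blast
        then have "\<alpha> - e / 2 \<in> L" "e > 0" by auto
        moreover from this(1) have "\<alpha> \<le> \<alpha> - e / 2" unfolding \<alpha>_def by (rule cInf_lower[OF _ bdd])
        ultimately show False by simp
      qed
      have "u \<alpha> * exp (- B * \<alpha>) \<ge> u s * exp (- B * s)"
      proof (rule DERIV_nonpos_imp_decreasing_open[OF \<alpha>s])
        show "continuous_on {\<alpha>..s} (\<lambda>t. u t * exp (- B * t))"
          by (intro continuous_intros DERIV_continuous_on[OF has_field_derivative_at_within[OF u]])
        fix t assume t: "\<alpha> < t" "t < s"
        have "((\<lambda>t. u t * exp (- B * t)) has_real_derivative (v t - B * u t) * exp (- B * t)) (at t)"
          by (auto intro!: derivative_eq_intros u simp: algebra_simps)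
        moreover have "(v t - B * u t) * exp (- B * t) \<le> 0"
          using B[OF in_L] t by (intro mult_nonpos_nonneg) auto
        ultimately show "\<exists>y. ((\<lambda>t. u t * exp (- B * t)) has_real_derivative y) (at t) \<and> y \<le> 0" by blast
      qed
      moreover have "u s * exp (- B * s) > 0" by (simp add: us)
      ultimately have "u \<alpha> * exp (- B * \<alpha>) > 0" by (rule less_le_trans[rotated])
      then have "u \<alpha> > 0" by (simp add: zero_less_mult_iff)
      then have "u t > 0" if "t \<in> {\<alpha>..s}" for t
        using that in_L L(4) by (cases "t = \<alpha>") auto
      then have "{\<alpha>..s} \<subseteq> L" using \<alpha>s by (intro L(5)) (auto simp: is_interval_cc)
      with \<open>\<alpha> \<notin> L\<close> \<alpha>s show False by auto
    qed
  qed
  finally show ?thesis by (simp add: x0_def)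
qed

lemma life_reflect:
  assumes h: "bcont h"
  shows "t \<in> life (\<lambda>t. h (- t)) (- s) (- x0) \<longleftrightarrow> - t \<in> life h s x0"
proof -
  have 1: "- t \<in> life (\<lambda>t. h (- t)) (- s) (- x0)" if h: "bcont h" and t: "t \<in> life h s x0" for h s x0 t
  proof -
    have "uminus ` life h s x0 \<subseteq> life (\<lambda>t. h (- t)) (- s) (- x0)"
    proof (rule life_properties(5)[OF bcont_reflect[OF h]])
      show "is_interval (uminus ` life h s x0)"
        using life_properties(2)[OF h] unfolding is_interval_connected_1
        by (rule connected_continuous_image[rotated]) (intro continuous_intros)
      show "- s \<in> uminus ` life h s x0" using life_properties(3)[OF h] by simp
      show "U (\<lambda>t. h (- t)) (- s) (- x0) t > 0" if "t \<in> uminus ` life h s x0" for t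
        using that life_properties(4)[OF h] by (auto simp: U_reflect[OF h])
    qed
    then show ?thesis using t by blast
  qed
  show ?thesis using 1[OF h, of "- t" s x0] 1[OF bcont_reflect[OF h], of t "- s" "- x0"] by auto
qed

text \<open>The reflection \<open>(t, y) \<mapsto> (-t, -y)\<close> maps solutions for \<open>p\<close> to solutions for \<open>t \<mapsto> p (-t)\<close>, because
the arctangent is odd.\<close>

lemma bounded_below_right_iff:
  assumes p: "bcont p"
  shows "bounded_below_right p c s y0 \<longleftrightarrow> bounded_above_left (\<lambda>t. p (- t)) c (- s) (- y0)"
proof -
  define x0 where "x0 = y0 - \<Gamma> c s"
  have x0': "- y0 - \<Gamma> c (- s) = - x0" by (simp add: x0_def \<Gamma>_minus)
  note h = bcont_drive[OF p, of c] and p' = bcont_reflect[OF p]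
  define f where "f t = \<Gamma> c t + V (drive p c) s x0 t / U (drive p c) s x0 t" for t
  define L where "L = life (drive p c) s x0"
  have below: "bounded_below_right p c s y0 \<longleftrightarrow> bdd_below (f ` (L \<inter> {s..}))"
    unfolding bounded_below_right_def max_interval_eq[OF p] x0_def[symmetric] L_def[symmetric]
    by (rule arg_cong[where f=bdd_below], rule image_cong)
      (auto simp: max_solution_eq[OF p] x0_def f_def L_def)
  have L': "life (drive (\<lambda>t. p (- t)) c) (- s) (- x0) = uminus ` L"
  proof (rule set_eqI)
    fix t show "t \<in> life (drive (\<lambda>t. p (- t)) c) (- s) (- x0) \<longleftrightarrow> t \<in> uminus ` L"
      unfolding drive_reflect life_reflect[OF h] L_def
      by (metis add.inverse_inverse image_eqI image_iff)
  qed
  have "max_solution (E (\<lambda>t. p (- t)) c) t (- s) (- y0) = - f (- t)" if t: "t \<in> uminus ` L" for t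
  proof -
    have "t \<in> life (drive (\<lambda>t. p (- t)) c) (- s) (- y0 - \<Gamma> c (- s))"
      unfolding x0' using t L' by simp
    from max_solution_eq[OF p' this]
    have "max_solution (E (\<lambda>t. p (- t)) c) t (- s) (- y0) = \<Gamma> c t +
        V (\<lambda>t. drive p c (- t)) (- s) (- x0) (- (- t)) / U (\<lambda>t. drive p c (- t)) (- s) (- x0) (- (- t))"
      unfolding x0' drive_reflect by simp
    also have "\<dots> = - f (- t)"
      unfolding U_reflect[OF h] f_def by (simp add: \<Gamma>_minus)
    finally show ?thesis .
  qed
  then have "bounded_above_left (\<lambda>t. p (- t)) c (- s) (- y0) \<longleftrightarrow>
      bdd_above ((\<lambda>t. - f (- t)) ` (uminus ` L \<inter> {..- s}))"
    unfolding bounded_above_left_def max_interval_eq[OF p'] x0' L'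
    by (intro arg_cong[where f=bdd_above] image_cong) auto
  also have "(\<lambda>t. - f (- t)) ` (uminus ` L \<inter> {..- s}) = uminus ` (f ` (L \<inter> {s..}))"
    by force
  also have "bdd_above (uminus ` (f ` (L \<inter> {s..}))) \<longleftrightarrow> bdd_below (f ` (L \<inter> {s..}))"
    by (simp add: bdd_above_uminus)
  finally show ?thesis using below by simp
qed

lemma R_minus_iff:
  assumes "bcont p" shows "s \<in> R_minus p c \<longleftrightarrow> (\<exists>x0. pos_left (drive p c) s x0)"
proof -
  have "s \<in> R_minus p c \<longleftrightarrow> (\<exists>y0. pos_left (drive p c) s (y0 - \<Gamma> c s))"
    unfolding R_minus_def bounded_above_left_iff[OF assms] by simp
  also have "\<dots> \<longleftrightarrow> (\<exists>x0. pos_left (drive p c) s x0)" by (metis add_diff_cancel_right')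
  finally show ?thesis .
qed

lemma bounded_above_left_greatest:
  assumes p: "bcont p" and s: "s \<in> R_minus p c"
  shows "bounded_above_left p c s (\<Gamma> c s + amax (drive p c) s)"
    "bounded_above_left p c s y0 \<Longrightarrow> y0 \<le> \<Gamma> c s + amax (drive p c) s"
proof -
  obtain x0 where x0: "pos_left (drive p c) s x0" using s R_minus_iff[OF p] by blast
  note a = amax[OF bcont_drive[OF p] x0]
  show "bounded_above_left p c s (\<Gamma> c s + amax (drive p c) s)"
    unfolding bounded_above_left_iff[OF p] using a(1) by simp
  show "bounded_above_left p c s y0 \<Longrightarrow> y0 \<le> \<Gamma> c s + amax (drive p c) s"
    unfolding bounded_above_left_iff[OF p] using a(2)[of "y0 - \<Gamma> c s"] by simp
qed

lemma a_sol_eq: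
  assumes "bcont p" "s \<in> R_minus p c"
  shows "a_sol p c s = \<Gamma> c s + amax (drive p c) s"
  unfolding a_sol_def using bounded_above_left_greatest[OF assms] by (rule Greatest_equality)

lemma R_plus_iff:
  assumes "bcont p" shows "s \<in> R_plus p c \<longleftrightarrow> - s \<in> R_minus (\<lambda>t. p (- t)) c"
  unfolding R_plus_def R_minus_def bounded_below_right_iff[OF assms]
proof -
  have "(\<exists>y. P (- y)) \<longleftrightarrow> (\<exists>y. P y)" for P :: "real \<Rightarrow> bool" by (metis minus_minus)
  then show "s \<in> {s. \<exists>y0. bounded_above_left (\<lambda>t. p (- t)) c (- s) (- y0)} \<longleftrightarrow>
      - s \<in> {s. \<exists>y0. bounded_above_left (\<lambda>t. p (- t)) c s y0}" by blast
qed

lemma r_sol_eq: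
  assumes p: "bcont p" and s: "s \<in> R_plus p c"
  shows "r_sol p c s = - a_sol (\<lambda>t. p (- t)) c (- s)"
proof -
  have s': "- s \<in> R_minus (\<lambda>t. p (- t)) c" using R_plus_iff[OF p] s by simp
  note g = bounded_above_left_greatest[OF bcont_reflect[OF p] s', folded a_sol_eq[OF bcont_reflect[OF p] s']]
  show ?thesis unfolding r_sol_def bounded_below_right_iff[OF p]
  proof (rule Least_equality)
    show "bounded_above_left (\<lambda>t. p (- t)) c (- s) (- (- a_sol (\<lambda>t. p (- t)) c (- s)))" using g(1) by simp
    show "- a_sol (\<lambda>t. p (- t)) c (- s) \<le> y" if "bounded_above_left (\<lambda>t. p (- t)) c (- s) (- y)" for y
      using g(2)[OF that] by simp
  qed
qed

lemma r_tendsto_reflect: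
  assumes p: "bcont p" and a: "a_tendsto_neg_half_lines (\<lambda>t. p (- t)) (\<lambda>t. - b (- t)) F"
  shows "r_tendsto_pos_half_lines p b F"
  unfolding r_tendsto_pos_half_lines_def
proof (intro allI conjI)
  fix k
  have sub: "\<forall>\<^sub>F c in F. {..- k} \<subseteq> R_minus (\<lambda>t. p (- t)) c"
    and lim: "uniform_limit {..- k} (a_sol (\<lambda>t. p (- t))) (\<lambda>t. - b (- t)) F"
    using a unfolding a_tendsto_neg_half_lines_def by auto
  show sub': "\<forall>\<^sub>F c in F. {k..} \<subseteq> R_plus p c"
    using sub by eventually_elim (auto simp: R_plus_iff[OF p] subset_iff)
  show "uniform_limit {k..} (r_sol p) b F"
    unfolding uniform_limit_iff
  proof (intro allI impI)
    fix e :: real assume "e > 0"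
    with lim have "\<forall>\<^sub>F c in F. \<forall>x\<in>{..- k}. dist (a_sol (\<lambda>t. p (- t)) c x) (- b (- x)) < e"
      unfolding uniform_limit_iff by blast
    with sub' show "\<forall>\<^sub>F c in F. \<forall>x\<in>{k..}. dist (r_sol p c x) (b x) < e"
    proof eventually_elim
      case (elim c)
      show ?case
      proof
        fix x assume x: "x \<in> {k..}"
        then have "r_sol p c x = - a_sol (\<lambda>t. p (- t)) c (- x)" using elim(1) by (intro r_sol_eq[OF p]) auto
        moreover have "dist (a_sol (\<lambda>t. p (- t)) c (- x)) (- b (- (- x))) < e"
          using x by (intro elim(2)[rule_format]) simp
        ultimately show "dist (r_sol p c x) (b x) < e" by (simp add: dist_real_def)
      qed
    qed
  qed
qed

text \<open>The definite description behind \<open>lambda_star\<close> is proper by \<open>threshold_exists\<close>.\<close>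

lemma lambda_star:
  assumes p: "bcont p"
  shows "(\<exists>x. riccati (\<lambda>t. drive p c t + m) x UNIV) \<longleftrightarrow> lambda_star p c \<le> m"
proof -
  note h = bcont_drive[OF p, of c]
  have eq: "(\<lambda>t x. - x\<^sup>2 + p t - q c t + m) = (\<lambda>t x. - x\<^sup>2 + (drive p c t + m))" for m
    by (simp add: drive_def fun_eq_iff)
  have "lambda_star p c = (THE l. \<forall>m. (\<exists>x. riccati (\<lambda>t. drive p c t + m) x UNIV) \<longleftrightarrow> l \<le> m)"
    unfolding lambda_star_def eq bounded_solution_iff_riccati[OF bcont_add_const[OF h]] ..
  from theI'[OF threshold_exists[OF h], folded this] show ?thesis by (rule spec)
qed

section \<open>Convergence\<close>

text \<open>The pair to which the perturbation lemma is applied consists of \<open>\<beta>\<close> and the solution through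
\<open>(k, \<beta> k - 1)\<close>; their separation on \<open>(-\<infinity>, k]\<close> comes from the pair \<open>x\<^sub>1\<close>, \<open>x\<^sub>2\<close> near \<open>-\<infinity>\<close>, where
\<open>q\<^bsub>c0\<^esub>\<close> is small.\<close>

lemma a_tendsto:
  assumes p: "bcont p" and x1: "riccati p x1 UNIV" and x2: "riccati p x2 UNIV"
    and gap: "\<And>t. \<epsilon> \<le> x1 t - x2 t" and \<epsilon>: "\<epsilon> > 0" and c0: "c0 > 0"
    and \<beta>: "riccati (drive p c0) \<beta> UNIV" and max: "\<And>t. amax (drive p c0) t = \<beta> t"
    and F: "F \<le> nhds c0"
  shows "a_tendsto_neg_half_lines p (\<lambda>t. \<Gamma> c0 t + \<beta> t) F"
  unfolding a_tendsto_neg_half_lines_def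
proof
  fix k
  note h = bcont_drive[OF p]
  have "pos_left (drive p c0) k (\<beta> k - 1)"
    by (rule lower_solution_pos_left[OF h riccatiD[OF \<beta>]]) auto
  then obtain y where y: "riccati (drive p c0) y {..k}" "y k = \<beta> k - 1"
    using pos_left_riccati[OF h] by blast
  have "7 / 64 * \<epsilon>\<^sup>2 > 0" using \<epsilon> by simp
  from q_tail[OF c0 this] obtain T where T: "\<And>t. \<bar>t\<bar> \<ge> T \<Longrightarrow> \<bar>q c0 t\<bar> \<le> 7 / 64 * \<epsilon>\<^sup>2" by blast
  have yk: "y k < amax (drive p c0) k" using y(2) max by simp
  have near: "\<bar>drive p c0 t - p t\<bar> \<le> 7 / 64 * \<epsilon>\<^sup>2" if "t \<le> - \<bar>T\<bar>" for t
    using T[of t] that by (simp add: drive_def)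
  obtain \<epsilon>' where \<epsilon>': "\<epsilon>' > 0" "\<And>t. t \<le> k \<Longrightarrow> \<epsilon>' \<le> amax (drive p c0) t - y t"
    by (rule amax_separated[OF p h riccati_subset[OF x1] riccati_subset[OF x2] gap \<epsilon> near y(1) yk]) auto
  have sep: "\<epsilon>' \<le> \<beta> t - y t" if "t \<le> k" for t using \<epsilon>'(2)[OF that] max by simp
  obtain B1 where B1: "\<And>t. t \<le> k \<Longrightarrow> \<bar>y t\<bar> \<le> B1" using riccati_bounded_left[OF h y(1)] by blast
  obtain B2 where B2: "\<And>t. t \<le> k \<Longrightarrow> \<bar>\<beta> t\<bar> \<le> B2"
    using riccati_bounded_left[OF h riccati_subset[OF \<beta>]] by blast
  define D where "D = B1 + B2 + 1"
  have D: "\<beta> t - y t \<le> D" if "t \<le> k" for t using B1[OF that] B2[OF that] by (simp add: D_def)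
  have D0: "D > 0" using B1[of k] B2[of k] by (simp add: D_def)
  have main: "\<forall>\<^sub>F c in F. {..k} \<subseteq> R_minus p c \<and> (\<forall>t\<in>{..k}. dist (a_sol p c t) (\<Gamma> c0 t + \<beta> t) < e)"
    if e: "e > 0" for e
  proof -
    define \<theta> where "\<theta> = min (1 / 2) (e / (4 * D))"
    have \<theta>: "0 < \<theta>" "\<theta> < 1" "\<theta> * D \<le> e / 4"
    proof -
      show "0 < \<theta>" "\<theta> < 1" using e D0 by (auto simp: \<theta>_def)
      have "\<theta> * D \<le> e / (4 * D) * D" using D0 by (intro mult_right_mono) (auto simp: \<theta>_def)
      then show "\<theta> * D \<le> e / 4" using D0 by simp
    qed
    define \<delta> where "\<delta> = min (\<theta> * (1 - \<theta>) * \<epsilon>'\<^sup>2) (min (c0 / 2) (c0 * (e / 4)))"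
    have "\<delta> > 0" using \<theta> \<epsilon>' c0 e by (simp add: \<delta>_def)
    then have "\<forall>\<^sub>F c in nhds c0. dist c c0 < \<delta>" by (auto simp: eventually_nhds_metric)
    then have "\<forall>\<^sub>F c in F. dist c c0 < \<delta>" using F by (simp add: le_filter_def)
    then show ?thesis
    proof eventually_elim
      case (elim c)
      then have c: "\<bar>c - c0\<bar> \<le> \<theta> * (1 - \<theta>) * \<epsilon>'\<^sup>2" "c0 / 2 \<le> c" "\<bar>c - c0\<bar> \<le> c0 * (e / 4)"
        by (auto simp: \<delta>_def dist_real_def abs_if split: if_splits)
      have close: "\<bar>drive p c t - drive p c0 t\<bar> \<le> \<theta> * (1 - \<theta>) * \<epsilon>'\<^sup>2" for t
        using q_lipschitz[of c t c0] c(1) by (simp add: drive_def)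
      note P = amax_perturbation[OF h h riccati_subset[OF \<beta>] y(1) sep \<epsilon>'(1) \<theta>(1,2) close]
      have R: "t \<in> R_minus p c" if "t \<le> k" for t
      proof -
        have "\<exists>x0. pos_left (drive p c) t x0" by (rule P(1)) (use that in auto)
        then show ?thesis using R_minus_iff[OF p] by blast
      qed
      have "dist (a_sol p c t) (\<Gamma> c0 t + \<beta> t) < e" if t: "t \<le> k" for t
      proof -
        have "\<bar>amax (drive p c) t - \<beta> t\<bar> \<le> \<theta> * (\<beta> t - y t)" by (rule P(2)) (use t in auto)
        also have "\<dots> \<le> \<theta> * D" using D[OF t] \<theta> by (intro mult_left_mono) auto
        finally have 1: "\<bar>amax (drive p c) t - \<beta> t\<bar> \<le> e / 4" using \<theta>(3) by simp
        have "1 / c0 * \<bar>c - c0\<bar> \<le> 1 / c0 * (c0 * (e / 4))" using c(3) c0 by (intro mult_left_mono) auto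
        also have "\<dots> = e / 4" using c0 by simp
        finally have 2: "\<bar>\<Gamma> c t - \<Gamma> c0 t\<bar> \<le> e / 4" using \<Gamma>_lipschitz[OF c0 c(2), of t] by linarith
        show ?thesis unfolding dist_real_def a_sol_eq[OF p R[OF t]] using 1 2 e by linarith
      qed
      with R show ?case by auto
    qed
  qed
  show "(\<forall>\<^sub>F c in F. {..k} \<subseteq> R_minus p c) \<and> uniform_limit {..k} (a_sol p) (\<lambda>t. \<Gamma> c0 t + \<beta> t) F"
  proof
    show "\<forall>\<^sub>F c in F. {..k} \<subseteq> R_minus p c" using main[of 1] by (auto elim: eventually_mono)
    show "uniform_limit {..k} (a_sol p) (\<lambda>t. \<Gamma> c0 t + \<beta> t) F"
      unfolding uniform_limit_iff
    proof (intro allI impI)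
      fix e :: real assume "e > 0"
      from main[OF this] show "\<forall>\<^sub>F c in F. \<forall>t\<in>{..k}. dist (a_sol p c t) (\<Gamma> c0 t + \<beta> t) < e"
        by (rule eventually_mono) blast
    qed
  qed
qed

text \<open>The set is closed downward, and open because a positive \<open>u\<close> stays positive a little longer. It is
not the whole line, since otherwise \<open>amax\<close> would be a global solution.\<close>

lemma R_minus_half_line:
  assumes p: "bcont p" and ne: "R_minus p c \<noteq> {}" and none: "\<And>x. \<not> riccati (drive p c) x UNIV"
  shows "\<exists>l. R_minus p c = {..<l}"
proof -
  note h = bcont_drive[OF p, of c]
  have down: "t \<in> R_minus p c" if "s \<in> R_minus p c" "t \<le> s" for s t
    using that pos_left_mono[OF h] unfolding R_minus_iff[OF p] by blast
  have up: "\<exists>e>s. e \<in> R_minus p c" if "s \<in> R_minus p c" for s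
    using that pos_left_extend[OF h] unfolding R_minus_iff[OF p] by blast
  have "R_minus p c \<noteq> UNIV"
  proof
    assume "R_minus p c = UNIV"
    then have "riccati (drive p c) (amax (drive p c)) {..t}" for t
      using R_minus_iff[OF p, of t] amax_riccati[OF h] by auto
    then have "riccati (drive p c) (amax (drive p c)) UNIV" by (auto simp: riccati_def)
    with none show False by blast
  qed
  then obtain z where z: "z \<notin> R_minus p c" by blast
  have bdd: "bdd_above (R_minus p c)" unfolding bdd_above_def
    using z down by (meson linear)
  have "R_minus p c = {..<Sup (R_minus p c)}"
  proof (rule set_eqI)
    fix t show "t \<in> R_minus p c \<longleftrightarrow> t \<in> {..<Sup (R_minus p c)}"
    proof
      assume "t \<in> R_minus p c"
      with up obtain e where "e > t" "e \<in> R_minus p c" by blast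
      then show "t \<in> {..<Sup (R_minus p c)}" using cSup_upper[OF _ bdd] by fastforce
    next
      assume "t \<in> {..<Sup (R_minus p c)}"
      then obtain s where "s \<in> R_minus p c" "t < s" using less_cSup_iff[OF ne bdd] by auto
      then show "t \<in> R_minus p c" using down by (meson less_imp_le)
    qed
  qed
  then show ?thesis by blast
qed

theorem theorem4p16:
  fixes p :: "real \<Rightarrow> real" and c0 :: real and b :: "real \<Rightarrow> real"
  assumes "bounded (range p)"
    and "uniformly_continuous_on UNIV p"
    and "card {x. hyperbolic_solution (\<lambda>t x. - x\<^sup>2 + p t) x} = 2"
    and "c0 > 0"
    and "transversal_tipping p c0"
    and "bounded_solution (E p c0) b"
  shows "a_tendsto_neg_half_lines p b (at_left c0) \<and>
         r_tendsto_pos_half_lines p b (at_left c0) \<and>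
         (\<forall>\<^sub>F c in at_right c0. (\<exists>l. R_minus p c = {..<l}) \<and> (\<exists>l. R_plus p c = {l<..})) \<and>
         ((\<lambda>c. Sup (ereal ` R_minus p c)) \<longlongrightarrow> \<infinity>) (at_right c0) \<and>
         ((\<lambda>c. Inf (ereal ` R_plus p c)) \<longlongrightarrow> - \<infinity>) (at_right c0) \<and>
         a_tendsto_neg_half_lines p b (at_right c0) \<and>
         r_tendsto_pos_half_lines p b (at_right c0)"
proof -
  let ?mr = "\<lambda>f :: real \<Rightarrow> real. \<lambda>t. - f (- t)"
  \<comment> \<open>The primed objects are the reflected data; they satisfy the same hypotheses, so every statement about the past can be used for p and for p'.\<close>
  define p' where "p' = (\<lambda>t. p (- t))"
  have p: "bcont p" using assms(1,2) by (simp add: bcont_def uniformly_continuous_imp_continuous)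
  have p': "bcont p'" unfolding p'_def by (rule bcont_reflect[OF p])
  have refl: "riccati (\<lambda>t. f (- t)) (?mr x) UNIV" if "riccati f x UNIV" for f x
    using riccati_reflect[OF that] by simp
  obtain z1 z2 where "hyperbolic_solution (\<lambda>t x. - x\<^sup>2 + p t) z1"
    "hyperbolic_solution (\<lambda>t x. - x\<^sup>2 + p t) z2" "z1 \<noteq> z2"
    using assms(3) unfolding card_2_iff by blast
  from hyperbolic_pair_separated[OF p this] obtain x1 x2 \<epsilon> where
    x: "riccati p x1 UNIV" "riccati p x2 UNIV" and \<epsilon>: "\<epsilon> > 0" and gap: "\<And>t. \<epsilon> \<le> x1 t - x2 t" by metis
  have x': "riccati p' (?mr x2) UNIV" "riccati p' (?mr x1) UNIV"
    unfolding p'_def using refl[OF x(2)] refl[OF x(1)] by simp_all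
  have gap': "\<epsilon> \<le> ?mr x2 t - ?mr x1 t" for t using gap[of "- t"] by simp
  define \<beta> where "\<beta> t = b t - \<Gamma> c0 t" for t
  have \<beta>: "riccati (drive p c0) \<beta> UNIV"
    using assms(6) unfolding bounded_solution_def global_solution_def riccati_def \<beta>_def E_deriv_iff by blast
  have drive': "drive p' c = (\<lambda>t. drive p c (- t))" for c unfolding p'_def by (rule drive_reflect)
  have \<beta>': "riccati (drive p' c0) (?mr \<beta>) UNIV" unfolding drive' by (rule refl[OF \<beta>])
  have star0: "lambda_star p c0 = 0" using assms(5) by (simp add: transversal_tipping_def)
  have minimal: "\<not> riccati (\<lambda>t. drive p c0 t + m) x UNIV" if "m < 0" for m x
    using lambda_star[OF p, of c0 m] star0 that by auto
  have minimal': "\<not> riccati (\<lambda>t. drive p' c0 t + m) x UNIV" if "m < 0" for m x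
    using minimal[OF that] refl[of "\<lambda>t. drive p' c0 t + m" x] unfolding drive' by auto
  have close: "\<exists>T. \<forall>t. \<bar>t\<bar> \<ge> T \<longrightarrow> \<bar>drive f c0 t - f t\<bar> \<le> \<eta>" if "\<eta> > 0" for \<eta> f
    using q_tail[OF assms(4) that] by (simp add: drive_def)
  have max: "amax (drive p c0) t = \<beta> t" for t
    by (rule amax_eq_at_threshold[OF p bcont_drive[OF p] x gap \<epsilon> close \<beta> minimal])
  have max': "amax (drive p' c0) t = ?mr \<beta> t" for t
    by (rule amax_eq_at_threshold[OF p' bcont_drive[OF p'] x' gap' \<epsilon> close \<beta>' minimal'])
  have b: "(\<lambda>t. \<Gamma> c0 t + \<beta> t) = b" "(\<lambda>t. \<Gamma> c0 t + ?mr \<beta> t) = (\<lambda>t. - b (- t))"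
    by (simp_all add: \<beta>_def \<Gamma>_minus fun_eq_iff)
  have a: "a_tendsto_neg_half_lines p b F" if "F \<le> nhds c0" for F
    using a_tendsto[OF p x gap \<epsilon> assms(4) \<beta> max that] by (simp add: b)
  have a': "a_tendsto_neg_half_lines p' (\<lambda>t. - b (- t)) F" if "F \<le> nhds c0" for F
    using a_tendsto[OF p' x' gap' \<epsilon> assms(4) \<beta>' max' that] unfolding b .
  have r: "r_tendsto_pos_half_lines p b F" if "F \<le> nhds c0" for F
    using r_tendsto_reflect[OF p] a'[OF that] unfolding p'_def by blast
  have F: "at_left c0 \<le> nhds c0" "at_right c0 \<le> nhds c0"
    by (simp_all add: at_within_def)
  have Rm: "\<forall>\<^sub>F c in at_right c0. {..k} \<subseteq> R_minus p c" for k
    using a[OF F(2)] by (simp add: a_tendsto_neg_half_lines_def)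
  have Rm': "\<forall>\<^sub>F c in at_right c0. {..k} \<subseteq> R_minus p' c" for k
    using a'[OF F(2)] by (simp add: a_tendsto_neg_half_lines_def)
  have Rp: "\<forall>\<^sub>F c in at_right c0. {k..} \<subseteq> R_plus p c" for k
    using r[OF F(2)] by (simp add: r_tendsto_pos_half_lines_def)
  obtain \<delta> where \<delta>: "\<delta> > 0" "\<And>c. c \<in> {c0<..c0 + \<delta>} \<Longrightarrow> lambda_star p c > 0"
    using assms(5) unfolding transversal_tipping_def by blast
  have "\<forall>\<^sub>F c in at_right c0. lambda_star p c > 0"
    unfolding eventually_at_right_field using \<delta> by (intro exI[of _ "c0 + \<delta>"]) auto
  with Rm[of 0] Rm'[of 0]
  have half: "\<forall>\<^sub>F c in at_right c0. (\<exists>l. R_minus p c = {..<l}) \<and> (\<exists>l. R_plus p c = {l<..})"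
  proof eventually_elim
    case (elim c)
    have none: "\<not> riccati (drive p c) x UNIV" for x
      using lambda_star[OF p, of c 0] elim(3) by auto
    have none': "\<not> riccati (drive p' c) x UNIV" for x
      using none refl[of "drive p' c" x] unfolding drive' by auto
    have "\<exists>l. R_minus p c = {..<l}" using elim(1) by (intro R_minus_half_line[OF p _ none]) auto
    moreover obtain l where l: "R_minus p' c = {..<l}"
      using elim(2) R_minus_half_line[OF p' _ none'] by blast
    have "R_plus p c = {- l<..}" using R_plus_iff[OF p, of _ c] l unfolding p'_def by auto
    ultimately show ?case by blast
  qed
  have "((\<lambda>c. Sup (ereal ` R_minus p c)) \<longlongrightarrow> \<infinity>) (at_right c0)"
    unfolding tendsto_PInfty
  proof
    fix k show "\<forall>\<^sub>F c in at_right c0. ereal k < Sup (ereal ` R_minus p c)"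
      using Rm[of "k + 1"]
    proof eventually_elim
      case (elim c)
      then have "ereal (k + 1) \<le> Sup (ereal ` R_minus p c)" by (intro Sup_upper) auto
      then show ?case by (rule less_le_trans[rotated]) simp
    qed
  qed
  moreover have "((\<lambda>c. Inf (ereal ` R_plus p c)) \<longlongrightarrow> - \<infinity>) (at_right c0)"
    unfolding tendsto_MInfty
  proof
    fix k show "\<forall>\<^sub>F c in at_right c0. Inf (ereal ` R_plus p c) < ereal k"
      using Rp[of "k - 1"]
    proof eventually_elim
      case (elim c)
      then have "Inf (ereal ` R_plus p c) \<le> ereal (k - 1)" by (intro Inf_lower) auto
      then show ?case by (rule le_less_trans) simp
    qed
  qed
  ultimately show ?thesis using a r F half by blast
qed

end
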